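(* Consider the distributed stochastic optimization setting described in the context: the problem $\min_{\theta\in\Omega} f(\theta)=\sum_{i=1}^N f_i(\theta)$, the communication graph with weight matrix $A$, the noises $\xi_{i,k}$ with constants $\delta\in(1,2]$ and $\nu>0$, the gradient bound $C_0>0$, and the iterates $x_{i,k}$ generated by the clipped distributed stochastic gradient projection algorithm with positive step-sizes $\alpha_k$ and positive clipping thresholds $\tau_k$. Suppose in addition that the constraint set $\Omega$ is bounded. Suppose that the sequence $(\alpha_k)_{k\ge0}$ is decreasing, the sequence $(\tau_k)_{k\ge 0}$ is increasing, and that (1) there is a $k_1>0$ such that $\tau_k\ge 2C_0$ for all $k\ge k_1$; (2) $\sum_{k=0}^{+\infty}\alpha_k=\infty$ and $\sum_{k=0}^{+\infty}\alpha_k^2<+\infty$; (3) $\lim_{k\to+\infty}\alpha_k\tau_k=0$ and $\sum_{k=0}^{+\infty}\alpha_k^2\tau_k^2<+\infty$; (4) $\sum_{k=0}^{+\infty}\alpha_k\tau_k^{1-\delta}<+\infty$. Then, with probability 1, for every $i\in\{1,\dots,N\}$, $x_{i,k}$ converges as $k\to+\infty$ to a vector in the optimal solution set $\Omega^*$.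
   Context: Problem. $N>1$ agents cooperate to solve $\min_{\theta\in\Omega} f(\theta)=\sum_{i=1}^N f_i(\theta)$, where $\Omega\subset\mathbb{R}^n$ and $f_i$ is the real-valued local objective of agent $i$. $\Omega^*$ denotes the set of minimizers of $f$ over $\Omega$. $\Vert\cdot\Vert$ is the Euclidean norm and $\mathbb{P}_\Omega$ the Euclidean projection onto $\Omega$. Standing assumptions. (A1) The agents communicate over a directed graph $\mathcal{G}_N$ with node set $\mathcal{V}_N=\{1,\dots,N\}$ and $N\times N$ nonnegative weight matrix $A$, where $[A]_{i,j}$ is the weight of the edge from $j$ to $i$. $\mathcal{N}_i$ is the set of agents whose states are available to agent $i$; $i\in\mathcal{N}_i$, and $j\in\mathcal{N}_i$ if and only if $[A]_{i,j}>0$. $\mathcal{G}_N$ is strongly connected (there is a directed path from any node to any other node). $A$ is doubly stochastic: $\sum_{i=1}^N[A]_{i,j}=\sum_{j=1}^N[A]_{i,j}=1$. There is $0<\eta<1$ with $[A]_{i,j}\ge\eta$ whenever $j\in\mathcal{N}_i$. (A2) Each $f_i$ is continuously differentiable and convex on $\Omega$. (A3) $\Omega$ is nonempty, closed and convex, and there is $C_0>0$ with $\Vert\nabla f_i(\theta)\Vert\le C_0$ for all $\theta\in\Omega$ and all $i$. (A4) $\Omega^*\neq\emptyset$. Algorithm. Given (deterministic) initial points $x_{i,0}\in\Omega$, for $k=0,1,2,\dots$ and $i\in\mathcal{V}_N$, $$v_{i,k}=\sum_{j=1}^N[A]_{i,j}x_{j,k},\qquad g_{i,k}=\nabla f_i(v_{i,k})+\xi_{i,k},$$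 $$\hat g_{i,k}=\min\left\{1,\frac{\tau_k}{\Vert g_{i,k}\Vert}\right\}g_{i,k},\qquad x_{i,k+1}=\mathbb{P}_\Omega\left[v_{i,k}-\alpha_k\hat g_{i,k}\right],$$ (with $\hat g_{i,k}=0$ when $g_{i,k}=0$), where $\alpha_k,\tau_k>0$ are deterministic sequences and $\xi_{i,k}$ is an $\mathbb{R}^n$-valued random noise. Noise assumptions. Let $\mathcal{F}_k=\sigma(\xi_{i,m};\ i\in\mathcal{V}_N,\ m=0,\dots,k-1)$. (A5) There exist $\delta\in(1,2]$ and $\nu>0$ such that $\mathbb{E}[\Vert\xi_{i,k}\Vert^\delta\mid\mathcal{F}_k]\le\nu^\delta$ with probability 1, for all $i,k$. (A6) $\mathbb{E}[\xi_{i,k}\mid\mathcal{F}_k]=0$ with probability 1, for all $i,k$. *)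

theory Defs
  imports "HOL-Probability.Probability" "Graph_Theory.Digraph_Component"
begin

(* Entry A $ i $ j is the weight of the edge from j to i. *)

definition in_neighbors :: "real ^ 'v ^ 'v \<Rightarrow> 'v \<Rightarrow> 'v set" where
  "in_neighbors A i = {j. A $ i $ j > 0}"

definition comm_graph :: "real ^ 'v ^ 'v \<Rightarrow> ('v, 'v \<times> 'v) pre_digraph" where
  "comm_graph A =
     \<lparr> verts = UNIV, arcs = {(j, i). j \<in> in_neighbors A i}, tail = fst, head = snd \<rparr>"

definition doubly_stochastic :: "real ^ 'v ^ 'v \<Rightarrow> bool" where
  "doubly_stochastic A \<longleftrightarrow>
     (\<forall>i j. A $ i $ j \<ge> 0) \<and> (\<forall>j. (\<Sum>i\<in>UNIV. A $ i $ j) = 1) \<and> (\<forall>i. (\<Sum>j\<in>UNIV. A $ i $ j) = 1)"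

(* G is a continuous gradient field of f on S. S need not be open, so the derivative is
   taken within S; this holds in particular if f is differentiable at the points of S in the
   ambient space with gradient G. *)
definition continuous_gradient_on ::
    "'a::real_inner set \<Rightarrow> ('a \<Rightarrow> real) \<Rightarrow> ('a \<Rightarrow> 'a) \<Rightarrow> bool" where
  "continuous_gradient_on S f G \<longleftrightarrow>
     (\<forall>\<theta>\<in>S. (f has_derivative (\<lambda>h. G \<theta> \<bullet> h)) (at \<theta> within S)) \<and> continuous_on S G"

definition minimizers :: "('a \<Rightarrow> real) \<Rightarrow> 'a set \<Rightarrow> 'a set" where
  "minimizers f S = {\<theta>. is_arg_min f (\<lambda>\<theta>. \<theta> \<in> S) \<theta>}"

(* Since x / 0 = 0, this yields clip t 0 = 0. *)
definition clip :: "real \<Rightarrow> 'a::real_normed_vector \<Rightarrow> 'a" where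
  "clip t g = min 1 (t / norm g) *\<^sub>R g"

(* One noise realization z is fixed; z i k is the noise of agent i at step k, and the result
   at k and i is the iterate of agent i after k steps. *)
primrec clipped_dsgp ::
    "real ^ 'v ^ 'v \<Rightarrow> 'a::euclidean_space set \<Rightarrow> ('v \<Rightarrow> 'a \<Rightarrow> 'a) \<Rightarrow> (nat \<Rightarrow> real) \<Rightarrow> (nat \<Rightarrow> real) \<Rightarrow>
     ('v \<Rightarrow> 'a) \<Rightarrow> ('v \<Rightarrow> nat \<Rightarrow> 'a) \<Rightarrow> nat \<Rightarrow> 'v \<Rightarrow> 'a" where
  "clipped_dsgp A S G \<alpha> \<tau> x0 z 0 = x0"
| "clipped_dsgp A S G \<alpha> \<tau> x0 z (Suc k) =
     (\<lambda>i. let v = (\<Sum>j\<in>UNIV. A $ i $ j *\<^sub>R clipped_dsgp A S G \<alpha> \<tau> x0 z k j);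
              g = G i v + z i k
          in closest_point S (v - \<alpha> k *\<^sub>R clip (\<tau> k) g))"

definition noise_history ::
    "'w measure \<Rightarrow> ('v \<Rightarrow> nat \<Rightarrow> 'w \<Rightarrow> 'a::topological_space) \<Rightarrow> nat \<Rightarrow> 'w measure" where
  "noise_history M \<xi> k =
     sigma (space M) {\<xi> i m -` B \<inter> space M | i m B. m < k \<and> B \<in> sets borel}"

definition vec_cond_exp ::
    "'w measure \<Rightarrow> 'w measure \<Rightarrow> ('w \<Rightarrow> real ^ 'n) \<Rightarrow> 'w \<Rightarrow> real ^ 'n" where
  "vec_cond_exp M F X \<omega> = (\<chi> j. real_cond_exp M F (\<lambda>\<omega>. X \<omega> $ j) \<omega>)"

end

theory Submission
  imports Defs
begin

text \<open>Fix a minimizer \<open>\<theta>\<close> and follow \<open>\<Sum>i. (norm (x i k - \<theta>))\<^sup>2\<close>. Mixing does not increase it, and the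
  projected step decreases it by \<open>2 * \<alpha> k\<close> times the optimality gap at the agents' mean, up to three
  errors: the consensus error, the squared step, and the deviation of the clipped gradients from the
  true ones. Mixing contracts the distance to consensus geometrically and each step perturbs it by at
  most \<open>\<alpha> k * \<tau> k\<close>, so the first two errors are summable for every noise realization. The third is
  the sum of a martingale difference with summable variances and of a conditional bias. A gradient is
  changed by clipping only if its norm exceeds \<open>\<tau> k\<close>, so the moment bound makes the bias of order
  \<open>\<tau> k powr (1 - \<delta>)\<close>. Hence, almost surely, the distances to all minimizers converge and the gap
  tends to zero along a subsequence; by compactness a further subsequence of the means converges to a
  minimizer, and the distance of all agents to that minimizer converges to zero.\<close>

section \<open>Convexity and real sequences\<close>

text \<open>By convexity the difference quotients of \<open>f\<close> along the segment from
  \<open>x\<close> to \<open>y\<close> are at most \<open>f y - f x\<close>, and they tend to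
  \<open>g \<bullet> (y - x)\<close>. The segment stays in \<open>S\<close>, so a derivative within
  \<open>S\<close> suffices and boundary points are covered.\<close>

lemma convex_on_gradient_le:
  fixes f :: "'a::real_inner \<Rightarrow> real"
  assumes "convex_on S f" and der: "(f has_derivative (\<lambda>h. g \<bullet> h)) (at x within S)"
    and "x \<in> S" "y \<in> S"
  shows "f x + g \<bullet> (y - x) \<le> f y"
proof -
  define c where "c t = x + t *\<^sub>R (y - x)" for t :: real
  have c_eq: "c t = (1 - t) *\<^sub>R x + t *\<^sub>R y" for t
    by (simp add: c_def algebra_simps)
  have "convex S"
    using assms(1) by (simp add: convex_on_def)
  then have c_in: "c ` {0..1} \<subseteq> S"
    using assms(3,4) by (auto simp: c_eq convex_def)
  have "(c has_derivative (\<lambda>t. t *\<^sub>R (y - x))) (at 0 within {0..1})"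
    unfolding c_def by (auto intro!: derivative_eq_intros)
  moreover have "(f has_derivative (\<lambda>h. g \<bullet> h)) (at (c 0) within c ` {0..1})"
    using has_derivative_subset[OF der c_in] by (simp add: c_def)
  ultimately have "(f \<circ> c has_derivative (\<lambda>h. g \<bullet> h) \<circ> (\<lambda>t. t *\<^sub>R (y - x))) (at 0 within {0..1})"
    by (rule diff_chain_within)
  then have "((f \<circ> c) has_field_derivative (g \<bullet> (y - x))) (at 0 within {0..1})"
    by (simp add: has_field_derivative_def o_def mult_commute_abs)
  then have lim: "((\<lambda>t. ((f \<circ> c) t - (f \<circ> c) 0) / (t - 0)) \<longlongrightarrow> g \<bullet> (y - x)) (at 0 within {0..1})"
    by (simp add: has_field_derivative_iff)
  have "\<forall>\<^sub>F t in at 0 within {0..1}. ((f \<circ> c) t - (f \<circ> c) 0) / (t - 0) \<le> f y - f x"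
    unfolding eventually_at_filter
  proof (intro always_eventually allI impI)
    fix t :: real
    assume t: "t \<noteq> 0" "t \<in> {0..1}"
    have "f (c t) \<le> (1 - t) * f x + t * f y"
      unfolding c_eq using t assms by (intro convex_onD) auto
    then have "f (c t) - f (c 0) \<le> t * (f y - f x)"
      by (simp add: c_def algebra_simps)
    then show "((f \<circ> c) t - (f \<circ> c) 0) / (t - 0) \<le> f y - f x"
      using t by (simp add: field_simps)
  qed
  moreover have "at (0::real) within {0..1} \<noteq> bot"
    by (simp add: at_within_Icc_at_right)
  ultimately have "g \<bullet> (y - x) \<le> f y - f x"
    by (intro tendsto_upperbound[OF lim])
  then show ?thesis
    by simp
qed

text \<open>The recursion telescopes: \<open>1 - c\<close> times a partial sum of \<open>a\<close>
  is at most \<open>a 0\<close> plus the corresponding partial sum of \<open>b\<close>.\<close>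

lemma summable_if_contraction:
  fixes a b :: "nat \<Rightarrow> real"
  assumes "\<And>k. a k \<ge> 0" "\<And>k. b k \<ge> 0" "summable b" "c < 1"
    and step: "\<And>k. a (Suc k) \<le> c * a k + b k"
  shows "summable a"
proof -
  have *: "(1 - c) * (\<Sum>k<n. a k) + a n \<le> a 0 + (\<Sum>k<n. b k)" for n
  proof (induction n)
    case (Suc n)
    then show ?case
      using step[of n] by (simp add: algebra_simps)
  qed simp
  have "(\<Sum>k<n. a k) \<le> (a 0 + suminf b) / (1 - c)" for n
  proof -
    have "(\<Sum>k<n. b k) \<le> suminf b"
      using assms by (intro sum_le_suminf) auto
    then have "(1 - c) * (\<Sum>k<n. a k) \<le> a 0 + suminf b"
      using *[of n] assms(1)[of n] by linarith
    then show ?thesis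
      using \<open>c < 1\<close> by (simp add: field_simps)
  qed
  then show ?thesis
    using assms(1) by (intro summableI_nonneg_bounded)
qed

text \<open>A deterministic form of the Robbins-Siegmund argument: \<open>V\<close> minus the
  partial sums of \<open>q\<close> decreases and is bounded below. The errors \<open>q\<close> may
  have either sign and converge only conditionally, as the noise series do later.\<close>

lemma almost_decreasing_convergent:
  fixes V p q :: "nat \<Rightarrow> real"
  assumes "\<And>k. V k \<ge> 0" "\<And>k. p k \<ge> 0" "summable q"
    and step: "\<And>k. V (Suc k) \<le> V k - p k + q k"
  shows "convergent V" "summable p"
proof -
  obtain Q where Q: "\<And>n. \<bar>\<Sum>k<n. q k\<bar> \<le> Q"
    using Bseq_eq_bounded summable_imp_sums_bounded[OF \<open>summable q\<close>]
    by (metis BseqE real_norm_def summable_imp_sums_bounded)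
  have *: "V n + (\<Sum>k<n. p k) \<le> V 0 + (\<Sum>k<n. q k)" for n
  proof (induction n)
    case (Suc n)
    then show ?case
      using step[of n] by simp
  qed simp
  have "(\<Sum>k<n. p k) \<le> V 0 + Q" for n
    using *[of n] Q[of n] assms(1)[of n] by linarith
  then show "summable p"
    using assms(2) by (intro summableI_nonneg_bounded)
  define W where "W n = V n - (\<Sum>k<n. q k)" for n
  have "W (Suc n) \<le> W n" for n
    using step[of n] assms(2)[of n] by (simp add: W_def)
  then have "decseq W"
    by (rule decseq_SucI)
  moreover have "- Q \<le> W n" for n
    using Q[of n] assms(1)[of n] by (simp add: W_def)
  ultimately have "convergent W"
    using decseq_convergent convergent_def by metis
  then have "convergent (\<lambda>n. W n + (\<Sum>k<n. q k))"
    using \<open>summable q\<close> by (intro convergent_add) (simp_all add: summable_iff_convergent)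
  then show "convergent V"
    by (simp add: W_def)
qed

section \<open>Contraction of the mixing step\<close>

lemma power2_norm_vec: "(norm (x :: 'a::real_normed_vector ^ 'v))\<^sup>2 = (\<Sum>i\<in>UNIV. (norm (x $ i))\<^sup>2)"
  by (simp add: norm_vec_def L2_set_def sum_nonneg)

text \<open>The states of all agents form one element of \<open>'a ^ 'v\<close>, whose norm is the
  Euclidean norm of the product space. On it \<open>mix A\<close> acts as the Kronecker product of
  \<open>A\<close> with the identity.\<close>

definition mix :: "real ^ 'v ^ 'v \<Rightarrow> 'a::real_vector ^ 'v \<Rightarrow> 'a ^ 'v" where
  "mix A x = (\<chi> i. \<Sum>j\<in>UNIV. A $ i $ j *\<^sub>R x $ j)"

definition mean :: "'a::real_vector ^ 'v \<Rightarrow> 'a" where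
  "mean x = (\<Sum>j\<in>UNIV. x $ j) /\<^sub>R CARD('v)"

text \<open>The orthogonal projection onto the joint states with sum zero, the complement of the
  consensus states.\<close>

definition deviation :: "'a::real_vector ^ 'v \<Rightarrow> 'a ^ 'v" where
  "deviation x = (\<chi> i. x $ i - mean x)"

lemma mix_scaleR: "mix A (c *\<^sub>R x) = c *\<^sub>R mix A x"
  by (simp add: mix_def vec_eq_iff scaleR_sum_right mult.commute)

lemma sum_mix:
  assumes "doubly_stochastic A"
  shows "(\<Sum>i\<in>UNIV. mix A x $ i) = (\<Sum>i\<in>UNIV. x $ i)"
proof -
  have "(\<Sum>i\<in>UNIV. mix A x $ i) = (\<Sum>j\<in>UNIV. (\<Sum>i\<in>UNIV. A $ i $ j) *\<^sub>R x $ j)"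
    by (simp add: mix_def scaleR_sum_left) (rule sum.swap)
  also have "\<dots> = (\<Sum>i\<in>UNIV. x $ i)"
    using assms by (simp add: doubly_stochastic_def)
  finally show ?thesis .
qed

lemma deviation_add: "deviation (x + y) = deviation x + deviation y"
  by (simp add: deviation_def mean_def vec_eq_iff sum.distrib algebra_simps)

lemma sum_deviation: "(\<Sum>i\<in>UNIV. deviation x $ i) = 0"
  by (simp add: deviation_def mean_def sum_subtractf sum_constant_scaleR)

lemma mix_deviation:
  assumes "doubly_stochastic A"
  shows "mix A (deviation x) = deviation (mix A x)"
proof -
  have "(\<Sum>j\<in>UNIV. A $ i $ j *\<^sub>R (x $ j - mean x)) = (\<Sum>j\<in>UNIV. A $ i $ j *\<^sub>R x $ j) - mean x" for i
    using assms by (simp add: scaleR_right_diff_distrib sum_subtractf doubly_stochastic_def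
        flip: scaleR_sum_left)
  then show ?thesis
    using sum_mix[OF assms, of x] by (simp add: mix_def deviation_def mean_def vec_eq_iff)
qed

text \<open>Pythagoras: the deviations sum to zero and are thus orthogonal to the constant vector of
  means.\<close>

lemma norm_deviation_le: "norm (deviation x) \<le> norm (x :: 'a::real_inner ^ 'v)"
proof (rule power2_le_imp_le)
  have "(norm (x $ i))\<^sup>2 = (norm (deviation x $ i))\<^sup>2 + (norm (mean x))\<^sup>2 + 2 * (deviation x $ i \<bullet> mean x)" for i
    by (simp add: deviation_def power2_norm_eq_inner algebra_simps inner_commute)
  then have "(norm x)\<^sup>2 = (norm (deviation x))\<^sup>2 + CARD('v) * (norm (mean x))\<^sup>2
      + 2 * ((\<Sum>i\<in>UNIV. deviation x $ i) \<bullet> mean x)"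
    by (simp add: power2_norm_vec sum.distrib inner_sum_left flip: sum_distrib_left)
  then show "(norm (deviation x))\<^sup>2 \<le> (norm x)\<^sup>2"
    by (simp add: sum_deviation)
qed simp

text \<open>Each row of \<open>A\<close> is a probability vector, so the weighted mean of squares is
  the square of the weighted mean plus a variance. Summing over the rows, the unit column sums
  restore the norm of \<open>x\<close>. The explicit variance term settles the case of equality
  below.\<close>

lemma norm_mix:
  fixes x :: "'a::real_inner ^ 'v"
  assumes "doubly_stochastic A"
  shows "(norm x)\<^sup>2 = (norm (mix A x))\<^sup>2
    + (\<Sum>i\<in>UNIV. \<Sum>j\<in>UNIV. A $ i $ j * (norm (x $ j - mix A x $ i))\<^sup>2)"
proof -
  have rows: "(\<Sum>j\<in>UNIV. A $ i $ j) = 1" and cols: "(\<Sum>i\<in>UNIV. A $ i $ j) = 1" for i j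
    using assms by (auto simp: doubly_stochastic_def)
  have "(\<Sum>j\<in>UNIV. A $ i $ j * (norm (x $ j))\<^sup>2) =
      (norm (mix A x $ i))\<^sup>2 + (\<Sum>j\<in>UNIV. A $ i $ j * (norm (x $ j - mix A x $ i))\<^sup>2)" for i
  proof -
    let ?v = "mix A x $ i"
    have v: "(\<Sum>j\<in>UNIV. A $ i $ j *\<^sub>R x $ j) = ?v"
      by (simp add: mix_def)
    have "(\<Sum>j\<in>UNIV. A $ i $ j * (norm (x $ j))\<^sup>2) =
      (\<Sum>j\<in>UNIV. A $ i $ j * (norm (x $ j - ?v))\<^sup>2 + 2 * ((A $ i $ j *\<^sub>R x $ j) \<bullet> ?v) - A $ i $ j * (norm ?v)\<^sup>2)"
      by (intro sum.cong) (auto simp: power2_norm_eq_inner algebra_simps inner_commute)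
    also have "\<dots> = (\<Sum>j\<in>UNIV. A $ i $ j * (norm (x $ j - ?v))\<^sup>2) + 2 * (?v \<bullet> ?v) - (norm ?v)\<^sup>2"
      unfolding sum_subtractf sum.distrib
      by (simp only: v rows mult_1 flip: sum_distrib_left sum_distrib_right inner_sum_left)
    finally show ?thesis
      by (simp add: power2_norm_eq_inner)
  qed
  then have "(\<Sum>i\<in>UNIV. \<Sum>j\<in>UNIV. A $ i $ j * (norm (x $ j))\<^sup>2) = (norm (mix A x))\<^sup>2
    + (\<Sum>i\<in>UNIV. \<Sum>j\<in>UNIV. A $ i $ j * (norm (x $ j - mix A x $ i))\<^sup>2)"
    by (simp add: power2_norm_vec sum.distrib)
  moreover have "(\<Sum>i\<in>UNIV. \<Sum>j\<in>UNIV. A $ i $ j * (norm (x $ j))\<^sup>2) = (norm x)\<^sup>2"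
    by (subst sum.swap) (simp add: cols power2_norm_vec flip: sum_distrib_right)
  ultimately show ?thesis
    by simp
qed

lemma norm_mix_le:
  fixes x :: "'a::real_inner ^ 'v"
  assumes "doubly_stochastic A"
  shows "norm (mix A x) \<le> norm x"
proof (rule power2_le_imp_le)
  have "(\<Sum>i\<in>UNIV. \<Sum>j\<in>UNIV. A $ i $ j * (norm (x $ j - mix A x $ i))\<^sup>2) \<ge> 0"
    using assms by (intro sum_nonneg) (auto simp: doubly_stochastic_def)
  then show "(norm (mix A x))\<^sup>2 \<le> (norm x)\<^sup>2"
    using norm_mix[OF assms, of x] by linarith
qed simp

text \<open>Equality makes all variances vanish, so neighbors agree; strong connectivity spreads
  this to all agents, and a constant vector with sum zero is zero.\<close>

lemma norm_mix_eq_imp_zero: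
  fixes x :: "'a::real_inner ^ 'v"
  assumes A: "doubly_stochastic A" "\<And>i. i \<in> in_neighbors A i" "strongly_connected (comm_graph A)"
    and eq: "norm (mix A x) = norm x" and zero: "(\<Sum>i\<in>UNIV. x $ i) = 0"
  shows "x = 0"
proof -
  have nn: "A $ i $ j \<ge> 0" for i j
    using A by (simp add: doubly_stochastic_def)
  have "(\<Sum>i\<in>UNIV. \<Sum>j\<in>UNIV. A $ i $ j * (norm (x $ j - mix A x $ i))\<^sup>2) = 0"
    using norm_mix[OF A(1), of x] eq by simp
  then have "A $ i $ j * (norm (x $ j - mix A x $ i))\<^sup>2 = 0" for i j
    using nn by (simp add: sum_nonneg_eq_0_iff sum_nonneg)
  then have "x $ j = mix A x $ i" if "j \<in> in_neighbors A i" for i j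
    using that by (force simp: in_neighbors_def)
  \<comment> \<open>By its self-loop, agent \<open>i\<close> is its own neighbor, which identifies
    \<open>mix A x $ i\<close> with \<open>x $ i\<close>.\<close>
  then have nb: "x $ j = x $ i" if "j \<in> in_neighbors A i" for i j
    using that A(2) by metis
  have "x $ u = x $ v" for u v
  proof -
    have "(u, v) \<in> rtrancl_on (verts (comm_graph A)) (arcs_ends (comm_graph A))"
      using A(3) by (simp add: strongly_connected_def reachable_def comm_graph_def)
    then have "(u, v) \<in> (arcs_ends (comm_graph A))\<^sup>*"
      by (rule rtrancl_on_rtranclI)
    then show ?thesis
    proof induction
      case (step y z)
      then have "y \<in> in_neighbors A z"
        by (auto simp: arcs_ends_conv comm_graph_def)
      then show ?case
        using nb step by metis
    qed simp
  qed
  then have "(\<Sum>i\<in>UNIV. x $ i) = (\<Sum>i\<in>(UNIV::'v set). x $ u)" for u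
    by (intro sum.cong) auto
  then have "x $ u = 0" for u
    using zero by (simp add: sum_constant_scaleR)
  then show ?thesis
    by (simp add: vec_eq_iff)
qed

text \<open>One step already contracts in the Euclidean norm: the norm of \<open>mix A\<close> attains its maximum
  on the unit sphere of the sum-zero subspace, and that maximum is below one.\<close>

lemma mix_contraction:
  assumes A: "doubly_stochastic A" "\<And>i. i \<in> in_neighbors A i" "strongly_connected (comm_graph A)"
  obtains c where "0 \<le> c" "c < 1"
    "\<And>x :: 'a::euclidean_space ^ 'v. (\<Sum>i\<in>UNIV. x $ i) = 0 \<Longrightarrow> norm (mix A x) \<le> c * norm x"
proof -
  define K where "K = {x :: 'a ^ 'v. (\<Sum>i\<in>UNIV. x $ i) = 0} \<inter> sphere 0 1"
  have cont: "continuous_on K (\<lambda>x. norm (mix A x))"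
    unfolding mix_def by (intro continuous_intros continuous_on_vec_lambda)
  have "closed {x :: 'a ^ 'v. (\<Sum>i\<in>UNIV. x $ i) = 0}"
    by (intro closed_Collect_eq continuous_intros)
  then have "compact K"
    unfolding K_def by (intro closed_Int_compact) auto
  have "\<exists>c. 0 \<le> c \<and> c < 1 \<and> (\<forall>x\<in>K. norm (mix A x) \<le> c)"
  proof (cases "K = {}")
    \<comment> \<open>This occurs for a single agent, where sum zero means
      \<open>x = 0\<close>.\<close>
    case True
    then show ?thesis
      by (intro exI[of _ 0]) auto
  next
    case False
    then obtain y where y: "y \<in> K" "\<forall>x\<in>K. norm (mix A x) \<le> norm (mix A y)"
      using continuous_attains_sup[OF \<open>compact K\<close> _ cont] by blast
    have "norm (mix A y) \<noteq> norm y"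
    proof
      assume "norm (mix A y) = norm y"
      then have "y = 0"
        using y(1) by (intro norm_mix_eq_imp_zero[OF A]) (auto simp: K_def)
      then show False
        using y(1) by (simp add: K_def)
    qed
    then have "norm (mix A y) < 1"
      using norm_mix_le[OF A(1), of y] y(1) by (simp add: K_def)
    then show ?thesis
      using y(2) by (intro exI[of _ "norm (mix A y)"]) auto
  qed
  then obtain c where c: "0 \<le> c" "c < 1" "\<And>x. x \<in> K \<Longrightarrow> norm (mix A x) \<le> c"
    by auto
  have "norm (mix A x) \<le> c * norm x" if x: "(\<Sum>i\<in>UNIV. x $ i) = 0" for x :: "'a ^ 'v"
  proof (cases "x = 0")
    case True
    then have "mix A x = 0"
      by (simp add: mix_def vec_eq_iff)
    then show ?thesis
      using True by simp
  next
    case False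
    have "(1 / norm x) *\<^sub>R x \<in> K"
      using x False by (simp add: K_def flip: scaleR_sum_right)
    from c(3)[OF this] show ?thesis
      using False by (simp add: mix_scaleR field_simps)
  qed
  with c show ?thesis
    by (intro that)
qed

section \<open>Convergence for a fixed noise realization\<close>

lemma minimizers_iff:
  fixes F :: "'a \<Rightarrow> real"
  shows "\<theta> \<in> minimizers F S \<longleftrightarrow> \<theta> \<in> S \<and> (\<forall>y\<in>S. F \<theta> \<le> F y)"
  by (auto simp: minimizers_def is_arg_min_linorder)

text \<open>The part free of probability: clipping enters only through the bound on
  \<open>g\<close>, the noise only through summability, possibly conditional, of the series in
  \<open>noise\<close>. That is required for all \<open>\<theta>\<close> at once because the cluster
  point to which it is finally applied depends on the realization.\<close>

theorem distributed_projection_convergence: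
  fixes X :: "nat \<Rightarrow> 'a::euclidean_space ^ 'v" and g :: "nat \<Rightarrow> 'v \<Rightarrow> 'a"
  assumes A: "doubly_stochastic A" "\<And>i. i \<in> in_neighbors A i" "strongly_connected (comm_graph A)"
    and grad: "\<And>i. continuous_gradient_on S (f i) (G i)" and conv: "\<And>i. convex_on S (f i)"
    and S: "closed S" "convex S" "bounded S"
    and C: "\<And>i \<theta>. \<theta> \<in> S \<Longrightarrow> norm (G i \<theta>) \<le> C"
    and ne: "minimizers (\<lambda>\<theta>. \<Sum>i\<in>UNIV. f i \<theta>) S \<noteq> {}"
    and X0: "\<And>i. X 0 $ i \<in> S"
    and X_Suc: "\<And>k i. X (Suc k) $ i = closest_point S (mix A (X k) $ i - \<alpha> k *\<^sub>R g k i)"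
    and g_le: "\<And>k i. norm (g k i) \<le> \<tau> k"
    and \<alpha>: "\<And>k. \<alpha> k > 0" "decseq \<alpha>" "filterlim (\<lambda>n. \<Sum>k<n. \<alpha> k) at_top sequentially"
      "summable (\<lambda>k. (\<alpha> k)\<^sup>2)" "summable (\<lambda>k. (\<alpha> k)\<^sup>2 * (\<tau> k)\<^sup>2)"
    and noise: "\<And>\<theta>. summable
      (\<lambda>k. \<alpha> k * (\<Sum>i\<in>UNIV. (g k i - G i (mix A (X k) $ i)) \<bullet> (mix A (X k) $ i - \<theta>)))"
  shows "\<exists>\<theta>\<in>minimizers (\<lambda>\<theta>. \<Sum>i\<in>UNIV. f i \<theta>) S. \<forall>i. (\<lambda>k. X k $ i) \<longlonglongrightarrow> \<theta>"
proof -

  \<comment> \<open>Feasibility and distance to the mean\<close>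
  define F where "F \<theta> = (\<Sum>i\<in>UNIV. f i \<theta>)" for \<theta>
  define N where "N = real CARD('v)"
  define v where "v k i = mix A (X k) $ i" for k i
  define m where "m k = mean (X k)" for k
  define e where "e k = norm (deviation (X k))" for k
  have N_pos: "N > 0"
    by (simp add: N_def)
  have \<tau>_nn: "\<tau> k \<ge> 0" for k
    using g_le[of k] norm_ge_zero order_trans by blast
  have nnA: "A $ i $ j \<ge> 0" and rowA: "(\<Sum>j\<in>UNIV. A $ i $ j) = 1" for i j
    using A(1) by (auto simp: doubly_stochastic_def)
  obtain \<theta>0 where "\<theta>0 \<in> minimizers F S"
    using ne unfolding F_def by blast
  then have \<theta>0: "\<theta>0 \<in> S" "\<And>y. y \<in> S \<Longrightarrow> F \<theta>0 \<le> F y"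
    by (auto simp: minimizers_iff)
  have "S \<noteq> {}"
    using \<theta>0 by auto
  have X_in: "X k $ i \<in> S" for k i
    using X0 \<open>S \<noteq> {}\<close> S by (cases k) (auto simp: X_Suc closest_point_in_set)
  have v_in: "v k i \<in> S" for k i
    unfolding v_def mix_def using nnA rowA X_in S by (auto intro!: convex_sum)
  have "(\<Sum>j\<in>UNIV. (1 / N) *\<^sub>R X k $ j) \<in> S" for k
    using S X_in by (intro convex_sum) (auto simp: N_def)
  then have m_in: "m k \<in> S" for k
    by (simp add: m_def mean_def N_def scaleR_sum_right divide_inverse)

  have C_nn: "0 \<le> C"
    using C[OF \<theta>0(1)] norm_ge_zero order_trans by blast
  have mean_mix: "mean (mix A (X k)) = m k" for k
    by (simp add: mean_def m_def sum_mix[OF A(1)])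
  \<comment> \<open>Mixing keeps the mean, so the left side is a component of the mixed deviation,
    and mixing is nonexpansive.\<close>
  have v_m: "norm (v k i - m k) \<le> e k" for k i
  proof -
    have "v k i - m k = deviation (mix A (X k)) $ i"
      by (simp add: v_def deviation_def mean_mix)
    also have "norm \<dots> \<le> norm (deviation (mix A (X k)))"
      by (rule Finite_Cartesian_Product.norm_nth_le)
    also have "\<dots> \<le> e k"
      unfolding e_def mix_deviation[OF A(1), symmetric] by (rule norm_mix_le[OF A(1)])
    finally show ?thesis .
  qed

  \<comment> \<open>Decay of the consensus error\<close>
  obtain c where c: "0 \<le> c" "c < 1"
    "\<And>x :: 'a ^ 'v. (\<Sum>i\<in>UNIV. x $ i) = 0 \<Longrightarrow> norm (mix A x) \<le> c * norm x"
    using mix_contraction[OF A] by metis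
  have e_Suc: "e (Suc k) \<le> c * e k + N * (\<alpha> k * \<tau> k)" for k
  proof -
    \<comment> \<open>\<open>?r\<close> is the displacement by the projected step. The point
      \<open>v k i\<close> is its own projection, so nonexpansiveness bounds each component by
      \<open>\<alpha> k * \<tau> k\<close>; the factor \<open>N\<close> comes from bounding the
      Euclidean norm by the sum of the component norms.\<close>
    let ?r = "X (Suc k) - mix A (X k)"
    have "norm (?r $ i) \<le> \<alpha> k * \<tau> k" for i
    proof -
      have "norm (?r $ i) = dist (closest_point S (v k i - \<alpha> k *\<^sub>R g k i)) (closest_point S (v k i))"
        using v_in by (simp add: X_Suc v_def dist_norm closest_point_self)
      also have "\<dots> \<le> dist (v k i - \<alpha> k *\<^sub>R g k i) (v k i)"
        using S \<open>S \<noteq> {}\<close> by (intro closest_point_lipschitz)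
      also have "\<dots> \<le> \<alpha> k * \<tau> k"
        using \<alpha>(1)[of k] g_le[of k i] by (simp add: dist_norm)
      finally show ?thesis .
    qed
    then have "(\<Sum>i\<in>UNIV. norm (?r $ i)) \<le> N * (\<alpha> k * \<tau> k)"
      unfolding N_def by (intro sum_bounded_above)
    moreover have "norm ?r \<le> (\<Sum>i\<in>UNIV. norm (?r $ i))"
      unfolding norm_vec_def by (rule L2_set_le_sum) simp
    moreover have "norm (deviation ?r) \<le> norm ?r"
      by (rule norm_deviation_le)
    moreover have "norm (mix A (deviation (X k))) \<le> c * e k"
      unfolding e_def by (intro c sum_deviation)
    moreover have "deviation (X (Suc k)) = mix A (deviation (X k)) + deviation ?r"
      by (simp add: mix_deviation[OF A(1)] flip: deviation_add)
    ultimately show ?thesis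
      unfolding e_def using norm_triangle_ineq[of "mix A (deviation (X k))" "deviation ?r"] by simp
  qed
  have e_nn: "e k \<ge> 0" for k
    by (simp add: e_def)

  \<comment> \<open>This is the forcing term in the recursion for
    \<open>\<alpha> k * e k\<close>.\<close>
  have "summable (\<lambda>k. (\<alpha> k)\<^sup>2 * \<tau> k)"
  proof (rule summable_comparison_test')
    show "summable (\<lambda>k. (\<alpha> k)\<^sup>2 + (\<alpha> k)\<^sup>2 * (\<tau> k)\<^sup>2)"
      using \<alpha> by (intro summable_add)
    have "t \<le> 1 + t\<^sup>2" for t :: real
      using zero_le_power2[of "t - 1/2"] by (simp add: power2_eq_square algebra_simps)
    then have "(\<alpha> k)\<^sup>2 * \<tau> k \<le> (\<alpha> k)\<^sup>2 * (1 + (\<tau> k)\<^sup>2)" for k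
      by (intro mult_left_mono) auto
    then show "norm ((\<alpha> k)\<^sup>2 * \<tau> k) \<le> (\<alpha> k)\<^sup>2 + (\<alpha> k)\<^sup>2 * (\<tau> k)\<^sup>2" if "k \<ge> 0" for k
      using \<tau>_nn[of k] by (simp add: algebra_simps)
  qed
  then have sum_b: "summable (\<lambda>k. N * ((\<alpha> k)\<^sup>2 * \<tau> k))"
    by (rule summable_mult)
  have sum_\<alpha>e: "summable (\<lambda>k. \<alpha> k * e k)"
  proof (rule summable_if_contraction[OF _ _ sum_b \<open>c < 1\<close>])
    fix k
    \<comment> \<open>As \<open>\<alpha>\<close> decreases, multiplying the recursion of
      \<open>e\<close> by the step size keeps the contraction factor \<open>c\<close>.\<close>
    have "\<alpha> (Suc k) * e (Suc k) \<le> \<alpha> k * e (Suc k)"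
      using e_nn \<alpha>(2) by (intro mult_right_mono) (auto simp: decseq_Suc_iff)
    also have "\<dots> \<le> \<alpha> k * (c * e k + N * (\<alpha> k * \<tau> k))"
      using e_Suc[of k] \<alpha>(1)[of k] by (intro mult_left_mono) auto
    finally show "\<alpha> (Suc k) * e (Suc k) \<le> c * (\<alpha> k * e k) + N * ((\<alpha> k)\<^sup>2 * \<tau> k)"
      by (simp add: algebra_simps power2_eq_square)
  qed (use \<alpha>(1) e_nn \<tau>_nn N_pos in \<open>auto intro!: mult_nonneg_nonneg simp: less_imp_le\<close>)
  have "summable (\<lambda>k. (e k)\<^sup>2)"
  proof (rule summable_if_contraction[OF _ _ _ \<open>c < 1\<close>])
    show "summable (\<lambda>k. N\<^sup>2 / (1 - c) * ((\<alpha> k)\<^sup>2 * (\<tau> k)\<^sup>2))"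
      using \<alpha> by (intro summable_mult)
    show "0 \<le> N\<^sup>2 / (1 - c) * ((\<alpha> k)\<^sup>2 * (\<tau> k)\<^sup>2)" for k
      using \<open>c < 1\<close> by simp
    fix k
    \<comment> \<open>With this \<open>t\<close> the bound on \<open>e (Suc k)\<close> becomes the
      convex combination \<open>c * e k + (1 - c) * t\<close>, so convexity of the square keeps the
      factor \<open>c\<close> for the squares.\<close>
    define t where "t = N * (\<alpha> k * \<tau> k) / (1 - c)"
    have t: "N * (\<alpha> k * \<tau> k) = (1 - c) * t"
      using \<open>c < 1\<close> by (simp add: t_def)
    have "(e (Suc k))\<^sup>2 \<le> (c * e k + (1 - c) * t)\<^sup>2"
      using e_Suc[of k] e_nn by (intro power_mono) (auto simp: t)
    also have "\<dots> = c * (e k)\<^sup>2 + (1 - c) * t\<^sup>2 - c * (1 - c) * (e k - t)\<^sup>2"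
      by (simp add: power2_eq_square algebra_simps)
    also have "\<dots> \<le> c * (e k)\<^sup>2 + (1 - c) * t\<^sup>2"
      using c by simp
    also have "(1 - c) * t\<^sup>2 = N\<^sup>2 / (1 - c) * ((\<alpha> k)\<^sup>2 * (\<tau> k)\<^sup>2)"
      using \<open>c < 1\<close> by (simp add: t_def power2_eq_square divide_simps)
    finally show "(e (Suc k))\<^sup>2 \<le> c * (e k)\<^sup>2 + N\<^sup>2 / (1 - c) * ((\<alpha> k)\<^sup>2 * (\<tau> k)\<^sup>2)" .
  qed simp
  then have e_lim: "e \<longlonglongrightarrow> 0"
    using summable_LIMSEQ_zero power_tendsto_0_iff[of 2 e sequentially] by force

  \<comment> \<open>Lyapunov inequality\<close>
  define V where "V \<theta> k = (norm (X k - (\<chi> i. \<theta>)))\<^sup>2" for \<theta> k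
  define gap where "gap k = F (m k) - F \<theta>0" for k
  have gap_nn: "gap k \<ge> 0" for k
    using \<theta>0(2)[OF m_in] by (simp add: gap_def)
  \<comment> \<open>Stated for every minimizer, since it is used twice: at \<open>\<theta>0\<close>
    to find a good subsequence, and at the limit of that subsequence.\<close>
  have lyapunov: "convergent (V \<theta>)" "summable (\<lambda>k. 2 * (\<alpha> k * gap k))"
    if \<theta>: "\<theta> \<in> S" "F \<theta> = F \<theta>0" for \<theta>
  proof -
    define w where "w k = (\<Sum>i\<in>UNIV. (g k i - G i (v k i)) \<bullet> (v k i - \<theta>))" for k
    \<comment> \<open>The three errors: evaluating the objectives at the mean, the noise, and the
      squared step.\<close>
    define q where "q k = 2 * N * C * (\<alpha> k * e k) - 2 * (\<alpha> k * w k) + N * ((\<alpha> k)\<^sup>2 * (\<tau> k)\<^sup>2)" for k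
    have "summable q"
      unfolding q_def using sum_\<alpha>e noise[of \<theta>] \<alpha>(5)
      by (intro summable_add summable_diff summable_mult) (auto simp: w_def v_def)
    have "V \<theta> (Suc k) \<le> V \<theta> k - 2 * (\<alpha> k * gap k) + q k" for k
    proof -
      have "(norm (X (Suc k) $ i - \<theta>))\<^sup>2 \<le>
          (norm (v k i - \<theta>))\<^sup>2 - 2 * \<alpha> k * (g k i \<bullet> (v k i - \<theta>)) + (\<alpha> k)\<^sup>2 * (\<tau> k)\<^sup>2" for i
      proof -
        \<comment> \<open>Since \<open>\<theta>\<close> is its own projection, nonexpansiveness
          removes the projection; then the square is expanded.\<close>
        have "norm (X (Suc k) $ i - \<theta>) = dist (closest_point S (v k i - \<alpha> k *\<^sub>R g k i)) (closest_point S \<theta>)"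
          using \<theta> by (simp add: X_Suc v_def dist_norm closest_point_self)
        also have "\<dots> \<le> norm (v k i - \<alpha> k *\<^sub>R g k i - \<theta>)"
          unfolding dist_norm[symmetric] using S \<open>S \<noteq> {}\<close> by (intro closest_point_lipschitz)
        finally have "(norm (X (Suc k) $ i - \<theta>))\<^sup>2 \<le> (norm (v k i - \<alpha> k *\<^sub>R g k i - \<theta>))\<^sup>2"
          by (intro power_mono) auto
        also have "\<dots> = (norm (v k i - \<theta>))\<^sup>2 - 2 * \<alpha> k * (g k i \<bullet> (v k i - \<theta>)) + (\<alpha> k)\<^sup>2 * (norm (g k i))\<^sup>2"
          unfolding power2_norm_eq_inner by (simp add: algebra_simps inner_commute power2_eq_square)
        finally show ?thesis
          using g_le[of k i] power_mono[OF g_le[of k i] norm_ge_zero, of 2]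
            mult_left_mono[of "(norm (g k i))\<^sup>2" "(\<tau> k)\<^sup>2" "(\<alpha> k)\<^sup>2"] by simp
      qed
      then have "V \<theta> (Suc k) \<le> (\<Sum>i\<in>UNIV. (norm (v k i - \<theta>))\<^sup>2 - 2 * \<alpha> k * (g k i \<bullet> (v k i - \<theta>)) + (\<alpha> k)\<^sup>2 * (\<tau> k)\<^sup>2)"
        unfolding V_def power2_norm_vec by (intro sum_mono) simp
      also have "\<dots> = (\<Sum>i\<in>UNIV. (norm (v k i - \<theta>))\<^sup>2) - 2 * \<alpha> k * (\<Sum>i\<in>UNIV. g k i \<bullet> (v k i - \<theta>)) + N * ((\<alpha> k)\<^sup>2 * (\<tau> k)\<^sup>2)"
        by (simp add: sum.distrib sum_subtractf sum_distrib_left N_def)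
      finally have 1: "V \<theta> (Suc k) \<le> (\<Sum>i\<in>UNIV. (norm (v k i - \<theta>))\<^sup>2)
          - 2 * \<alpha> k * (\<Sum>i\<in>UNIV. g k i \<bullet> (v k i - \<theta>)) + N * ((\<alpha> k)\<^sup>2 * (\<tau> k)\<^sup>2)" .
      have "mix A (X k - (\<chi> i. \<theta>)) $ i = v k i - \<theta>" for i
        by (simp add: mix_def v_def scaleR_right_diff_distrib sum_subtractf rowA flip: scaleR_sum_left)
      then have 2: "(\<Sum>i\<in>UNIV. (norm (v k i - \<theta>))\<^sup>2) \<le> V \<theta> k"
        using power_mono[OF norm_mix_le[OF A(1), of "X k - (\<chi> i. \<theta>)"] norm_ge_zero, of 2]
        by (simp add: V_def power2_norm_vec[of "mix A _"])
      \<comment> \<open>Two gradient inequalities, from \<open>v k i\<close> to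
        \<open>\<theta>\<close> and from \<open>m k\<close> to \<open>v k i\<close>. Passing to the
        common point \<open>m k\<close> costs \<open>C * e k\<close> but lets the local objectives
        add up to \<open>F (m k)\<close>.\<close>
      have "f i (m k) - f i \<theta> - C * e k \<le> G i (v k i) \<bullet> (v k i - \<theta>)" for i
      proof -
        have der: "(f i has_derivative (\<lambda>h. G i y \<bullet> h)) (at y within S)" if "y \<in> S" for y
          using grad[of i] that by (simp add: continuous_gradient_on_def)
        have "f i (v k i) + G i (v k i) \<bullet> (\<theta> - v k i) \<le> f i \<theta>"
          by (intro convex_on_gradient_le[OF conv der] v_in \<theta>)
        moreover have "f i (m k) + G i (m k) \<bullet> (v k i - m k) \<le> f i (v k i)"
          by (intro convex_on_gradient_le[OF conv der] v_in m_in)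
        moreover have "\<bar>G i (m k) \<bullet> (v k i - m k)\<bar> \<le> C * e k"
          by (rule order_trans[OF Cauchy_Schwarz_ineq2 mult_mono[OF C[OF m_in] v_m C_nn]]) simp
        ultimately show ?thesis
          by (simp add: inner_diff_right)
      qed
      then have "(\<Sum>i\<in>UNIV. f i (m k) - f i \<theta> - C * e k) \<le> (\<Sum>i\<in>UNIV. G i (v k i) \<bullet> (v k i - \<theta>))"
        by (intro sum_mono)
      moreover have "(\<Sum>i\<in>UNIV. g k i \<bullet> (v k i - \<theta>)) = (\<Sum>i\<in>UNIV. G i (v k i) \<bullet> (v k i - \<theta>)) + w k"
        by (simp add: w_def inner_diff_left sum_subtractf)
      ultimately have "gap k - N * (C * e k) + w k \<le> (\<Sum>i\<in>UNIV. g k i \<bullet> (v k i - \<theta>))"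
        using \<theta>(2) by (simp add: sum_subtractf gap_def F_def N_def)
      then have "2 * \<alpha> k * (gap k - N * (C * e k) + w k) \<le> 2 * \<alpha> k * (\<Sum>i\<in>UNIV. g k i \<bullet> (v k i - \<theta>))"
        using \<alpha>(1)[of k] by (intro mult_left_mono) auto
      with 1 2 show ?thesis
        by (simp add: q_def algebra_simps)
    qed
    moreover have "0 \<le> V \<theta> k" "0 \<le> 2 * (\<alpha> k * gap k)" for k
      using gap_nn \<alpha>(1) by (simp_all add: V_def less_imp_le)
    ultimately show "convergent (V \<theta>)" "summable (\<lambda>k. 2 * (\<alpha> k * gap k))"
      using almost_decreasing_convergent[OF _ _ \<open>summable q\<close>, of "V \<theta>" "\<lambda>k. 2 * (\<alpha> k * gap k)"] by blast+
  qed

  \<comment> \<open>A minimizer as cluster point\<close>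
  have "\<exists>k\<ge>n. gap k < \<epsilon>" if "\<epsilon> > 0" for \<epsilon> n
  proof (rule ccontr)
    assume "\<not> ?thesis"
    then have ge: "gap k \<ge> \<epsilon>" if "k \<ge> n" for k
      using that by force
    \<comment> \<open>A gap bounded away from zero would turn summability of
      \<open>\<alpha> k * gap k\<close> into summability of the step sizes.\<close>
    have "summable (\<lambda>k. \<epsilon> * \<alpha> k)"
    proof (rule summable_comparison_test')
      show "summable (\<lambda>k. 2 * (\<alpha> k * gap k))"
        using lyapunov \<theta>0 by blast
      show "norm (\<epsilon> * \<alpha> k) \<le> 2 * (\<alpha> k * gap k)" if "k \<ge> n" for k
        using mult_right_mono[OF ge[OF that], of "\<alpha> k"] \<alpha>(1)[of k] \<open>\<epsilon> > 0\<close> gap_nn[of k]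
        by (simp add: mult.commute)
    qed
    then have "summable \<alpha>"
      using \<open>\<epsilon> > 0\<close> by (simp add: summable_cmult_iff)
    then have "(\<lambda>n. \<Sum>k<n. \<alpha> k) \<longlonglongrightarrow> suminf \<alpha>"
      by (rule summable_LIMSEQ)
    then show False
      using \<alpha>(3) not_tendsto_and_filterlim_at_infinity[of sequentially]
        filterlim_at_top_imp_at_infinity trivial_limit_sequentially by blast
  qed
  then have "\<exists>k. \<forall>j. k j \<ge> j \<and> gap (k j) < 1 / real (Suc j)"
    by (intro choice) (auto simp: Bex_def)
  then obtain k where k: "\<And>j. k j \<ge> j" "\<And>j. gap (k j) < 1 / real (Suc j)"
    by blast
  have "compact S"
    using S by (simp add: compact_eq_bounded_closed)
  then obtain \<theta> r where \<theta>: "\<theta> \<in> S" and r: "strict_mono r" and lim: "((\<lambda>j. m (k j)) \<circ> r) \<longlonglongrightarrow> \<theta>"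
    unfolding compact_def using m_in by (metis (mono_tags, lifting))
  \<comment> \<open>The indices \<open>k j\<close> need not increase, but \<open>k j \<ge> j\<close>
    makes \<open>s\<close> tend to infinity, which is enough to pass to limits along it.\<close>
  define s where "s = k \<circ> r"
  have s: "filterlim s at_top sequentially"
  proof (rule filterlim_at_top_mono)
    show "filterlim r at_top sequentially"
      using r by (rule filterlim_subseq)
    show "\<forall>\<^sub>F j in sequentially. r j \<le> s j"
      using k by (simp add: s_def)
  qed
  have m_lim: "(\<lambda>j. m (s j)) \<longlonglongrightarrow> \<theta>"
    using lim by (simp add: s_def o_def)
  have "(\<lambda>j. gap (k j)) \<longlonglongrightarrow> 0"
    by (rule tendsto_sandwich[OF _ _ tendsto_const LIMSEQ_Suc[OF lim_inverse_n']])
      (use k gap_nn in \<open>auto intro!: always_eventually less_imp_le\<close>)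
  then have "(\<lambda>j. gap (s j)) \<longlonglongrightarrow> 0"
    using LIMSEQ_subseq_LIMSEQ[OF _ r] by (fastforce simp: s_def o_def)
  moreover have "(\<lambda>j. gap (s j)) \<longlonglongrightarrow> F \<theta> - F \<theta>0"
  proof -
    have "continuous_on S (f i)" for i
      using grad[of i] by (auto simp: continuous_gradient_on_def continuous_on_eq_continuous_within
          intro: has_derivative_continuous)
    then have "continuous_on S F"
      unfolding F_def by (intro continuous_on_sum)
    then have "(\<lambda>j. F (m (s j))) \<longlonglongrightarrow> F \<theta>"
      by (rule continuous_on_tendsto_compose[OF _ m_lim \<theta>]) (simp add: m_in)
    then show ?thesis
      unfolding gap_def by (intro tendsto_intros)
  qed
  ultimately have F_eq: "F \<theta> = F \<theta>0"
    using LIMSEQ_unique by fastforce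

  \<comment> \<open>Convergence of the whole sequence\<close>
  have "(\<lambda>j. e (s j)) \<longlonglongrightarrow> 0"
    using e_lim s by (rule filterlim_compose)
  have "(\<lambda>j. X (s j) $ i) \<longlonglongrightarrow> \<theta>" for i
  proof -
    have "(\<lambda>j. deviation (X (s j)) $ i) \<longlonglongrightarrow> 0"
      using \<open>(\<lambda>j. e (s j)) \<longlonglongrightarrow> 0\<close> unfolding e_def
      by (rule Lim_null_comparison[rotated]) (simp add: Finite_Cartesian_Product.norm_nth_le)
    from tendsto_add[OF this m_lim] show ?thesis
      by (simp add: deviation_def m_def)
  qed
  then have "(\<lambda>j. \<Sum>i\<in>UNIV. (norm (X (s j) $ i - \<theta>))\<^sup>2) \<longlonglongrightarrow> (\<Sum>i\<in>(UNIV::'v set). (norm (\<theta> - \<theta>))\<^sup>2)"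
    by (intro tendsto_intros)
  then have "(\<lambda>j. V \<theta> (s j)) \<longlonglongrightarrow> 0"
    by (simp add: V_def power2_norm_vec)
  \<comment> \<open>\<open>V \<theta>\<close> converges along all indices, so its limit is the one
    found along \<open>s\<close>.\<close>
  moreover obtain L where L: "V \<theta> \<longlonglongrightarrow> L"
    using lyapunov(1)[OF \<theta> F_eq] by (auto simp: convergent_def)
  then have "(\<lambda>j. V \<theta> (s j)) \<longlonglongrightarrow> L"
    using s by (rule filterlim_compose)
  ultimately have "L = 0"
    using LIMSEQ_unique by fastforce
  then have "(\<lambda>k. norm (X k - (\<chi> i. \<theta>))) \<longlonglongrightarrow> 0"
    using L unfolding V_def by (simp add: power_tendsto_0_iff)
  then have "X \<longlonglongrightarrow> (\<chi> i. \<theta>)"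
    by (simp add: LIM_zero_iff tendsto_norm_zero_iff)
  then have "(\<lambda>k. X k $ i) \<longlonglongrightarrow> \<theta>" for i
    using tendsto_vec_nth[of X "\<chi> i. \<theta>"] by force
  moreover have "\<theta> \<in> minimizers F S"
    using \<theta> F_eq \<theta>0 by (simp add: minimizers_iff)
  ultimately show ?thesis
    unfolding F_def by blast
qed

section \<open>Series of martingale differences\<close>

text \<open>Martingale differences enter only through their orthogonality to bounded functions of the past. The
  partial sums, stopped once they reach \<open>\<epsilon>\<close>, have a bounded multiplier of \<open>d k\<close> as cross term in
  their second moment, so this orthogonality suffices without further integrability assumptions.\<close>

lemma (in prob_space) martingale_difference_maximal:
  fixes d :: "nat \<Rightarrow> 'a \<Rightarrow> real"
  assumes sub: "\<And>k. subalgebra M (F k)" and mono: "\<And>k. subalgebra (F (Suc k)) (F k)"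
    and d: "\<And>k. d k \<in> borel_measurable (F (Suc k))" "\<And>k. integrable M (\<lambda>\<omega>. (d k \<omega>)\<^sup>2)"
    and orth: "\<And>k h B. h \<in> borel_measurable (F k) \<Longrightarrow> (\<And>\<omega>. \<bar>h \<omega>\<bar> \<le> B) \<Longrightarrow> (\<integral>\<omega>. h \<omega> * d k \<omega> \<partial>M) = 0"
    and "\<epsilon> > 0"
  shows "prob {\<omega>\<in>space M. \<exists>j\<le>n. \<epsilon> \<le> \<bar>\<Sum>k<j. d k \<omega>\<bar>} \<le> (\<Sum>k<n. \<integral>\<omega>. (d k \<omega>)\<^sup>2 \<partial>M) / \<epsilon>\<^sup>2"
proof -
  define T where "T = rec_nat (\<lambda>\<omega>. 0) (\<lambda>k t \<omega>. t \<omega> + (if \<bar>t \<omega>\<bar> < \<epsilon> then d k \<omega> else 0))"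
  have T_0: "T 0 \<omega> = 0" and T_Suc: "T (Suc k) \<omega> = T k \<omega> + (if \<bar>T k \<omega>\<bar> < \<epsilon> then d k \<omega> else 0)" for k \<omega>
    by (simp_all add: T_def)
  have T_F: "T k \<in> borel_measurable (F k)" for k
  proof (induction k)
    case (Suc k)
    have [measurable]: "T k \<in> borel_measurable (F (Suc k))"
      by (rule measurable_from_subalg[OF mono Suc])
    note [measurable] = d(1)[of k]
    show ?case
      unfolding T_Suc[abs_def] by measurable
  qed (simp add: T_0[abs_def])
  have [measurable]: "T k \<in> borel_measurable M" "d k \<in> borel_measurable M" for k
    using measurable_from_subalg[OF sub] T_F d(1) by blast+
  have d_int: "integrable M (d k)" for k
    using square_integrable_imp_integrable d(2) by force

  have *: "integrable M (\<lambda>\<omega>. (T k \<omega>)\<^sup>2) \<and> (\<integral>\<omega>. (T k \<omega>)\<^sup>2 \<partial>M) \<le> (\<Sum>k<k. \<integral>\<omega>. (d k \<omega>)\<^sup>2 \<partial>M)" for k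
  proof (induction k)
    case (Suc k)
    define h where "h \<omega> = (if \<bar>T k \<omega>\<bar> < \<epsilon> then T k \<omega> else 0)" for \<omega>
    define q where "q \<omega> = (if \<bar>T k \<omega>\<bar> < \<epsilon> then (d k \<omega>)\<^sup>2 else 0)" for \<omega>
    have h_F: "h \<in> borel_measurable (F k)"
      using T_F[of k] unfolding h_def[abs_def] by measurable
    have [measurable]: "h \<in> borel_measurable M" "q \<in> borel_measurable M"
      unfolding h_def[abs_def] q_def[abs_def] by measurable
    have h_le: "\<bar>h \<omega>\<bar> \<le> \<epsilon>" for \<omega>
      using \<open>\<epsilon> > 0\<close> by (simp add: h_def)
    have sq: "(T (Suc k) \<omega>)\<^sup>2 = (T k \<omega>)\<^sup>2 + 2 * (h \<omega> * d k \<omega>) + q \<omega>" for \<omega>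
      by (simp add: T_Suc h_def q_def power2_eq_square algebra_simps)
    have hd: "integrable M (\<lambda>\<omega>. h \<omega> * d k \<omega>)"
      by (rule Bochner_Integration.integrable_bound[where f = "\<lambda>\<omega>. \<epsilon> * d k \<omega>"])
        (use h_le d_int \<open>\<epsilon> > 0\<close> in \<open>auto simp: abs_mult intro!: mult_right_mono\<close>)
    have q: "integrable M q"
      by (rule Bochner_Integration.integrable_bound[OF d(2)[of k]]) (auto simp: q_def)
    have "(\<integral>\<omega>. q \<omega> \<partial>M) \<le> (\<integral>\<omega>. (d k \<omega>)\<^sup>2 \<partial>M)"
      by (intro integral_mono q d) (simp add: q_def)
    moreover have "(\<integral>\<omega>. h \<omega> * d k \<omega> \<partial>M) = 0"
      by (rule orth[OF h_F h_le])
    ultimately show ?case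
      unfolding sq using Suc hd q by simp
  qed (simp add: T_0)

  \<comment> \<open>Either the threshold was never reached and the stopped sum is still the partial
    sum, or it is frozen at a value of modulus at least \<open>\<epsilon>\<close>. So the maximal
    event is an event about \<open>T n\<close> alone.\<close>
  have T_eq: "(\<forall>j\<le>n. \<bar>\<Sum>k<j. d k \<omega>\<bar> < \<epsilon>) \<and> T n \<omega> = (\<Sum>k<n. d k \<omega>) \<or> \<epsilon> \<le> \<bar>T n \<omega>\<bar>" for n \<omega>
  proof (induction n)
    case (Suc n)
    then show ?case
      by (auto simp: T_Suc le_Suc_eq not_less)
  qed (use \<open>\<epsilon> > 0\<close> in \<open>simp add: T_0\<close>)
  have "prob {\<omega>\<in>space M. \<exists>j\<le>n. \<epsilon> \<le> \<bar>\<Sum>k<j. d k \<omega>\<bar>} \<le> prob {\<omega>\<in>space M. \<epsilon>\<^sup>2 \<le> (T n \<omega>)\<^sup>2}"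
  proof (intro finite_measure_mono subsetI)
    fix \<omega>
    assume "\<omega> \<in> {\<omega>\<in>space M. \<exists>j\<le>n. \<epsilon> \<le> \<bar>\<Sum>k<j. d k \<omega>\<bar>}"
    then have "\<omega> \<in> space M" "\<epsilon> \<le> \<bar>T n \<omega>\<bar>"
      using T_eq[of n \<omega>] by force+
    then show "\<omega> \<in> {\<omega>\<in>space M. \<epsilon>\<^sup>2 \<le> (T n \<omega>)\<^sup>2}"
      using \<open>\<epsilon> > 0\<close> power_mono[of \<epsilon> "\<bar>T n \<omega>\<bar>" 2] by simp
  qed measurable
  also have "\<dots> \<le> (\<integral>\<omega>. (T n \<omega>)\<^sup>2 \<partial>M) / \<epsilon>\<^sup>2"
    using * \<open>\<epsilon> > 0\<close> by (intro integral_Markov_inequality_measure[where A = "{}"]) auto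
  also have "\<dots> \<le> (\<Sum>k<n. \<integral>\<omega>. (d k \<omega>)\<^sup>2 \<partial>M) / \<epsilon>\<^sup>2"
    using * by (intro divide_right_mono) auto
  finally show ?thesis .
qed

lemma (in prob_space) martingale_difference_tail:
  fixes d :: "nat \<Rightarrow> 'a \<Rightarrow> real"
  assumes sub: "\<And>k. subalgebra M (F k)" and mono: "\<And>k. subalgebra (F (Suc k)) (F k)"
    and d: "\<And>k. d k \<in> borel_measurable (F (Suc k))" "\<And>k. integrable M (\<lambda>\<omega>. (d k \<omega>)\<^sup>2)"
    and orth: "\<And>k h B. h \<in> borel_measurable (F k) \<Longrightarrow> (\<And>\<omega>. \<bar>h \<omega>\<bar> \<le> B) \<Longrightarrow> (\<integral>\<omega>. h \<omega> * d k \<omega> \<partial>M) = 0"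
    and summable: "summable (\<lambda>k. \<integral>\<omega>. (d k \<omega>)\<^sup>2 \<partial>M)"
    and "\<epsilon> > 0"
  shows "prob {\<omega>\<in>space M. \<exists>j. \<epsilon> \<le> \<bar>\<Sum>k<j. d k \<omega>\<bar>} \<le> (\<Sum>k. \<integral>\<omega>. (d k \<omega>)\<^sup>2 \<partial>M) / \<epsilon>\<^sup>2"
proof -
  have [measurable]: "d k \<in> borel_measurable M" for k
    using measurable_from_subalg[OF sub] d(1) by blast
  define E where "E n = {\<omega>\<in>space M. \<exists>j\<le>n. \<epsilon> \<le> \<bar>\<Sum>k<j. d k \<omega>\<bar>}" for n
  have "E n \<in> events" for n
    unfolding E_def by measurable
  then have "(\<lambda>n. prob (E n)) \<longlonglongrightarrow> prob (\<Union>n. E n)"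
    by (intro finite_Lim_measure_incseq) (auto simp: E_def incseq_def intro: order_trans)
  moreover have "prob (E n) \<le> (\<Sum>k. \<integral>\<omega>. (d k \<omega>)\<^sup>2 \<partial>M) / \<epsilon>\<^sup>2" for n
  proof -
    have "prob (E n) \<le> (\<Sum>k<n. \<integral>\<omega>. (d k \<omega>)\<^sup>2 \<partial>M) / \<epsilon>\<^sup>2"
      unfolding E_def by (rule martingale_difference_maximal[where F = F]) fact+
    also have "\<dots> \<le> (\<Sum>k. \<integral>\<omega>. (d k \<omega>)\<^sup>2 \<partial>M) / \<epsilon>\<^sup>2"
      using summable by (intro divide_right_mono sum_le_suminf) auto
    finally show ?thesis .
  qed
  ultimately have "prob (\<Union>n. E n) \<le> (\<Sum>k. \<integral>\<omega>. (d k \<omega>)\<^sup>2 \<partial>M) / \<epsilon>\<^sup>2"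
    by (intro LIMSEQ_le_const2) auto
  moreover have "(\<Union>n. E n) = {\<omega>\<in>space M. \<exists>j. \<epsilon> \<le> \<bar>\<Sum>k<j. d k \<omega>\<bar>}"
    by (auto simp: E_def)
  ultimately show ?thesis
    by simp
qed

theorem (in prob_space) martingale_difference_AE_summable:
  fixes d :: "nat \<Rightarrow> 'a \<Rightarrow> real"
  assumes sub: "\<And>k. subalgebra M (F k)" and mono: "\<And>k. subalgebra (F (Suc k)) (F k)"
    and d: "\<And>k. d k \<in> borel_measurable (F (Suc k))" "\<And>k. integrable M (\<lambda>\<omega>. (d k \<omega>)\<^sup>2)"
    and orth: "\<And>k h B. h \<in> borel_measurable (F k) \<Longrightarrow> (\<And>\<omega>. \<bar>h \<omega>\<bar> \<le> B) \<Longrightarrow> (\<integral>\<omega>. h \<omega> * d k \<omega> \<partial>M) = 0"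
    and summable: "summable (\<lambda>k. \<integral>\<omega>. (d k \<omega>)\<^sup>2 \<partial>M)"
  shows "AE \<omega> in M. summable (\<lambda>k. d k \<omega>)"
proof -
  have [measurable]: "d k \<in> borel_measurable M" for k
    using measurable_from_subalg[OF sub] d(1) by blast
  have AE: "AE \<omega> in M. \<not> (\<forall>m. \<exists>j. \<epsilon> \<le> \<bar>\<Sum>k<j. d (k + m) \<omega>\<bar>)" if "\<epsilon> > 0" for \<epsilon>
  proof (subst prob_Collect_eq_0[symmetric])
    let ?E = "{\<omega>\<in>space M. \<forall>m. \<exists>j. \<epsilon> \<le> \<bar>\<Sum>k<j. d (k + m) \<omega>\<bar>}"
    show "?E \<in> events"
      by measurable
    have "prob ?E \<le> r" if "r > 0" for r
    proof -
      \<comment> \<open>The remaining variance is so small that the tail bound gives probability at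
        most \<open>r\<close>.\<close>
      obtain m where m: "norm (\<Sum>k. \<integral>\<omega>. (d (k + m) \<omega>)\<^sup>2 \<partial>M) < r * \<epsilon>\<^sup>2"
        using suminf_exist_split[OF _ summable, of "r * \<epsilon>\<^sup>2"] \<open>r > 0\<close> \<open>\<epsilon> > 0\<close> by auto
      have "prob ?E \<le> prob {\<omega>\<in>space M. \<exists>j. \<epsilon> \<le> \<bar>\<Sum>k<j. d (k + m) \<omega>\<bar>}"
        by (intro finite_measure_mono) auto
      also have "\<dots> \<le> (\<Sum>k. \<integral>\<omega>. (d (k + m) \<omega>)\<^sup>2 \<partial>M) / \<epsilon>\<^sup>2"
      proof (rule martingale_difference_tail[where F = "\<lambda>k. F (k + m)"])
        show "(\<integral>\<omega>. h \<omega> * d (k + m) \<omega> \<partial>M) = 0"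
          if "h \<in> borel_measurable (F (k + m))" "\<And>\<omega>. \<bar>h \<omega>\<bar> \<le> B" for k h B
          using that by (rule orth)
        show "summable (\<lambda>k. \<integral>\<omega>. (d (k + m) \<omega>)\<^sup>2 \<partial>M)"
          using summable by (subst summable_iff_shift)
      qed (use sub mono d \<open>\<epsilon> > 0\<close> in simp_all)
      also have "\<dots> \<le> r"
        using m \<open>\<epsilon> > 0\<close> by (simp add: divide_le_eq)
      finally show ?thesis .
    qed
    \<comment> \<open>A positive probability would be at most half of itself.\<close>
    from this[of "prob ?E / 2"] show "prob ?E = 0"
      using measure_nonneg[of M ?E] by argo
  qed
  have "AE \<omega> in M. \<forall>i::nat. \<not> (\<forall>m. \<exists>j. 1 / Suc i \<le> \<bar>\<Sum>k<j. d (k + m) \<omega>\<bar>)"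
    unfolding AE_all_countable by (intro allI AE) simp
  then show ?thesis
  proof eventually_elim
    case (elim \<omega>)
    show ?case
      unfolding summable_Cauchy
    proof (intro allI impI)
      fix e :: real
      assume "e > 0"
      \<comment> \<open>The sum over \<open>{m..<n}\<close> is a difference of two sums starting at
        \<open>N\<close>, hence \<open>e / 2\<close>.\<close>
      then obtain i where i: "1 / real (Suc i) < e / 2"
        using nat_approx_posE[of "e / 2"] by auto
      obtain N where N: "\<And>j. \<bar>\<Sum>k<j. d (k + N) \<omega>\<bar> < e / 2"
        using elim i by (meson less_trans not_le)
      have "norm (\<Sum>k\<in>{m..<n}. d k \<omega>) < e" if "m \<ge> N" for m n
      proof (cases "m \<le> n")
        case True
        have S: "(\<Sum>k<j - N. d (k + N) \<omega>) = (\<Sum>k\<in>{N..<j}. d k \<omega>)" if "j \<ge> N" for j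
          using sum.shift_bounds_nat_ivl[of "\<lambda>k. d k \<omega>" 0 N "j - N"] that
          by (simp add: lessThan_atLeast0)
        have "(\<Sum>k\<in>{N..<m}. d k \<omega>) + (\<Sum>k\<in>{m..<n}. d k \<omega>) = (\<Sum>k\<in>{N..<n}. d k \<omega>)"
          using \<open>m \<ge> N\<close> True by (intro sum.atLeastLessThan_concat)
        then show ?thesis
          using N[of "m - N"] N[of "n - N"] S[of m] S[of n] \<open>m \<ge> N\<close> True by simp
      qed (use \<open>e > 0\<close> in simp)
      then show "\<exists>N. \<forall>m\<ge>N. \<forall>n. norm (\<Sum>k\<in>{m..<n}. d k \<omega>) < e"
        by blast
    qed
  qed
qed

text \<open>By Tonelli the series of absolute values has a finite integral, so it is finite almost
  everywhere.\<close>

lemma AE_summable_if_summable_integral: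
  fixes Y :: "nat \<Rightarrow> 'a \<Rightarrow> real"
  assumes int: "\<And>k. integrable M (Y k)" and summable: "summable (\<lambda>k. \<integral>\<omega>. \<bar>Y k \<omega>\<bar> \<partial>M)"
  shows "AE \<omega> in M. summable (\<lambda>k. Y k \<omega>)"
proof -
  have [measurable]: "Y k \<in> borel_measurable M" for k
    using int by auto
  have "(\<integral>\<^sup>+\<omega>. (\<Sum>k. ennreal \<bar>Y k \<omega>\<bar>) \<partial>M) = (\<Sum>k. \<integral>\<^sup>+\<omega>. ennreal \<bar>Y k \<omega>\<bar> \<partial>M)"
    by (intro nn_integral_suminf) measurable
  also have "\<dots> = (\<Sum>k. ennreal (\<integral>\<omega>. \<bar>Y k \<omega>\<bar> \<partial>M))"
    using int by (subst nn_integral_eq_integral) auto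
  also have "\<dots> \<noteq> \<infinity>"
    using summable by (simp add: suminf_ennreal_eq[OF _ summable_sums] ennreal_suminf_neq_top)
  finally have "AE \<omega> in M. (\<Sum>k. ennreal \<bar>Y k \<omega>\<bar>) \<noteq> \<infinity>"
    by (intro nn_integral_PInf_AE) auto
  then show ?thesis
  proof eventually_elim
    case (elim \<omega>)
    then have "summable (\<lambda>k. \<bar>Y k \<omega>\<bar>)"
      by (intro summable_suminf_not_top) auto
    then show ?case
      by (rule summable_rabs_cancel)
  qed
qed

section \<open>Clipped noise\<close>

lemma norm_clip_le: "0 \<le> t \<Longrightarrow> norm (clip t g) \<le> t"
  by (cases "g = 0") (auto simp: clip_def min_def field_simps)

text \<open>Where clipping acts it removes \<open>norm g - t\<close>, which is at most
  \<open>norm g powr (1 - \<delta>) * norm g powr \<delta>\<close>. The exponent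
  \<open>1 - \<delta>\<close> is negative and \<open>norm g > t\<close>, so the first factor is at
  most \<open>t powr (1 - \<delta>)\<close>.\<close>

lemma norm_clip_diff_le:
  assumes "0 < t" "1 < \<delta>"
  shows "norm (clip t g - g) \<le> t powr (1 - \<delta>) * norm g powr \<delta>"
proof (cases "norm g \<le> t")
  case True
  then have "clip t g = g"
    using \<open>0 < t\<close> by (cases "g = 0") (auto simp: clip_def min_def field_simps)
  then show ?thesis
    by simp
next
  case False
  then have g: "norm g > 0" "t < norm g"
    using \<open>0 < t\<close> by auto
  then have "clip t g - g = (t / norm g - 1) *\<^sub>R g"
    by (simp add: clip_def min_def algebra_simps)
  then have "norm (clip t g - g) = \<bar>t / norm g - 1\<bar> * norm g"
    by (simp only: norm_scaleR)
  also have "\<dots> = norm g - t"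
    using g \<open>0 < t\<close> by (simp add: abs_if field_simps)
  also have "\<dots> \<le> norm g powr (1 - \<delta>) * norm g powr \<delta>"
    using g \<open>0 < t\<close> by (simp flip: powr_add)
  also have "\<dots> \<le> t powr (1 - \<delta>) * norm g powr \<delta>"
    using g assms by (intro mult_right_mono powr_mono2') auto
  finally show ?thesis .
qed

lemma powr_add_le:
  fixes a b p :: real
  assumes "0 \<le> a" "0 \<le> b" "0 \<le> p"
  shows "(a + b) powr p \<le> 2 powr p * (a powr p + b powr p)"
proof -
  have "(a + b) powr p \<le> (2 * max a b) powr p"
    using assms by (intro powr_mono2) auto
  also have "\<dots> = 2 powr p * max a b powr p"
    using assms by (simp add: powr_mult)
  also have "\<dots> \<le> 2 powr p * (a powr p + b powr p)"
    by (intro mult_left_mono) (auto simp: max_def)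
  finally show ?thesis .
qed

lemma borel_measurable_clip [measurable (raw)]:
  fixes g :: "'w \<Rightarrow> 'a::euclidean_space"
  assumes [measurable]: "g \<in> borel_measurable N"
  shows "(\<lambda>\<omega>. clip t (g \<omega>)) \<in> borel_measurable N"
  unfolding clip_def by measurable

text \<open>The tower property, used for nonnegative integrals because integrability is itself part
  of the claim.\<close>

lemma (in prob_space) moment_le_of_cond_moment_le:
  assumes F: "subalgebra M F" and [measurable]: "\<xi> \<in> borel_measurable M"
    and "AE \<omega> in M. nn_cond_exp M F (\<lambda>\<omega>. ennreal (norm (\<xi> \<omega>) powr \<delta>)) \<omega> \<le> ennreal (\<nu> powr \<delta>)"
  shows "integrable M (\<lambda>\<omega>. norm (\<xi> \<omega>) powr \<delta>)" "expectation (\<lambda>\<omega>. norm (\<xi> \<omega>) powr \<delta>) \<le> \<nu> powr \<delta>"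
proof -
  interpret finite_measure_subalgebra M F
    using F by unfold_locales
  have "(\<integral>\<^sup>+\<omega>. ennreal (norm (\<xi> \<omega>) powr \<delta>) \<partial>M)
      = (\<integral>\<^sup>+\<omega>. nn_cond_exp M F (\<lambda>\<omega>. ennreal (norm (\<xi> \<omega>) powr \<delta>)) \<omega> \<partial>M)"
    using nn_cond_exp_intg[of "\<lambda>\<omega>. 1" "\<lambda>\<omega>. ennreal (norm (\<xi> \<omega>) powr \<delta>)"] by simp
  also have "\<dots> \<le> (\<integral>\<^sup>+\<omega>. ennreal (\<nu> powr \<delta>) \<partial>M)"
    using assms(3) by (rule nn_integral_mono_AE)
  also have "\<dots> = ennreal (\<nu> powr \<delta>)"
    by (simp add: emeasure_space_1)
  finally have le: "(\<integral>\<^sup>+\<omega>. ennreal (norm (\<xi> \<omega>) powr \<delta>) \<partial>M) \<le> ennreal (\<nu> powr \<delta>)" .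
  then show int: "integrable M (\<lambda>\<omega>. norm (\<xi> \<omega>) powr \<delta>)"
    by (intro integrableI_nonneg) (auto intro: le_less_trans)
  show "expectation (\<lambda>\<omega>. norm (\<xi> \<omega>) powr \<delta>) \<le> \<nu> powr \<delta>"
    using le by (subst (asm) nn_integral_eq_integral[OF int]) auto
qed

lemma (in prob_space) integrable_if_powr_integrable:
  fixes \<xi> :: "'a \<Rightarrow> 'b::{banach, second_countable_topology}"
  assumes [measurable]: "\<xi> \<in> borel_measurable M" and "1 < \<delta>"
    and int: "integrable M (\<lambda>\<omega>. norm (\<xi> \<omega>) powr \<delta>)"
  shows "integrable M \<xi>"
proof (rule Bochner_Integration.integrable_bound)
  show "integrable M (\<lambda>\<omega>. 1 + norm (\<xi> \<omega>) powr \<delta>)"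
    using int by simp
  have "x \<le> 1 + x powr \<delta>" if "0 \<le> x" for x :: real
  proof (cases "x \<le> 1")
    case True
    then show ?thesis
      using powr_ge_zero[of x \<delta>] by linarith
  next
    case False
    then show ?thesis
      using powr_mono[of 1 \<delta> x] \<open>1 < \<delta>\<close> by simp
  qed
  then show "AE \<omega> in M. norm (\<xi> \<omega>) \<le> norm (1 + norm (\<xi> \<omega>) powr \<delta>)"
    by simp
qed simp

text \<open>In each component, a bounded \<open>F\<close>-measurable factor can be integrated
  against the conditional expectation instead, which vanishes.\<close>

lemma (in prob_space) vec_cond_exp_zero_orthogonal:
  fixes \<xi> u :: "'a \<Rightarrow> real ^ 'n"
  assumes F: "subalgebra M F" and \<xi>: "integrable M \<xi>"
    and zero: "AE \<omega> in M. vec_cond_exp M F \<xi> \<omega> = 0"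
    and u [measurable]: "u \<in> borel_measurable F" and u_le: "\<And>\<omega>. norm (u \<omega>) \<le> B"
  shows "integrable M (\<lambda>\<omega>. \<xi> \<omega> \<bullet> u \<omega>)" "expectation (\<lambda>\<omega>. \<xi> \<omega> \<bullet> u \<omega>) = 0"
proof -
  interpret finite_measure_subalgebra M F
    using F by unfold_locales
  have u_j: "(\<lambda>\<omega>. u \<omega> $ j) \<in> borel_measurable F" for j
    unfolding cart_eq_inner_axis by measurable
  have [measurable]: "\<xi> \<in> borel_measurable M" "(\<lambda>\<omega>. u \<omega> $ j) \<in> borel_measurable M" for j
    using \<xi> measurable_from_subalg[OF F u_j] by auto
  have [measurable]: "(\<lambda>\<omega>. \<xi> \<omega> $ j) \<in> borel_measurable M" for j
    unfolding cart_eq_inner_axis by measurable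
  have int: "integrable M (\<lambda>\<omega>. u \<omega> $ j * \<xi> \<omega> $ j)" for j
  proof (rule Bochner_Integration.integrable_bound)
    show "integrable M (\<lambda>\<omega>. B * norm (\<xi> \<omega>))"
      using \<xi> by simp
    have "\<bar>u \<omega> $ j\<bar> * \<bar>\<xi> \<omega> $ j\<bar> \<le> B * norm (\<xi> \<omega>)" for \<omega>
      using u_le[of \<omega>] norm_ge_zero[of "u \<omega>"] component_le_norm_cart[of "u \<omega>" j] component_le_norm_cart[of "\<xi> \<omega>" j]
      by (intro mult_mono) linarith+
    then show "AE \<omega> in M. norm (u \<omega> $ j * \<xi> \<omega> $ j) \<le> norm (B * norm (\<xi> \<omega>))"
      by (intro always_eventually allI) (smt (verit) norm_mult real_norm_def)
  qed measurable
  have "(\<integral>\<omega>. u \<omega> $ j * \<xi> \<omega> $ j \<partial>M) = (\<integral>\<omega>. u \<omega> $ j * real_cond_exp M F (\<lambda>\<omega>. \<xi> \<omega> $ j) \<omega> \<partial>M)" for j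
    by (rule real_cond_exp_intg(2)[symmetric, OF int u_j]) measurable
  moreover have "AE \<omega> in M. real_cond_exp M F (\<lambda>\<omega>. \<xi> \<omega> $ j) \<omega> = 0" for j
    using zero by eventually_elim (simp add: vec_cond_exp_def vec_eq_iff)
  then have "(\<integral>\<omega>. u \<omega> $ j * real_cond_exp M F (\<lambda>\<omega>. \<xi> \<omega> $ j) \<omega> \<partial>M) = 0" for j
    by (intro integral_eq_zero_AE) force
  ultimately have "(\<integral>\<omega>. u \<omega> $ j * \<xi> \<omega> $ j \<partial>M) = 0" for j
    by simp
  with int show "integrable M (\<lambda>\<omega>. \<xi> \<omega> \<bullet> u \<omega>)" "expectation (\<lambda>\<omega>. \<xi> \<omega> \<bullet> u \<omega>) = 0"
    by (simp_all add: inner_vec_def mult.commute)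
qed

text \<open>Testing the conditional expectation against its own sign leaves only the part of the gradient
  that is cut off.\<close>

lemma (in prob_space) clip_bias_le:
  fixes \<xi> b u :: "'a \<Rightarrow> real ^ 'n"
  assumes F: "subalgebra M F" and \<xi>_M [measurable]: "\<xi> \<in> borel_measurable M"
    and b_F: "b \<in> borel_measurable F" and b_le: "\<And>\<omega>. norm (b \<omega>) \<le> C"
    and u_F: "u \<in> borel_measurable F" and u_le: "\<And>\<omega>. norm (u \<omega>) \<le> U"
    and moment: "AE \<omega> in M. nn_cond_exp M F (\<lambda>\<omega>. ennreal (norm (\<xi> \<omega>) powr \<delta>)) \<omega> \<le> ennreal (\<nu> powr \<delta>)"
    and zero: "AE \<omega> in M. vec_cond_exp M F \<xi> \<omega> = 0"
    and "1 < \<delta>" "0 < t"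
  shows "expectation (\<lambda>\<omega>. \<bar>real_cond_exp M F (\<lambda>\<omega>. (clip t (b \<omega> + \<xi> \<omega>) - b \<omega>) \<bullet> u \<omega>) \<omega>\<bar>)
    \<le> U * (2 powr \<delta> * (C powr \<delta> + \<nu> powr \<delta>)) * t powr (1 - \<delta>)"
proof -
  interpret finite_measure_subalgebra M F
    using F by unfold_locales
  note mom = moment_le_of_cond_moment_le[OF F \<xi>_M moment]
  have \<xi>_int: "integrable M \<xi>"
    by (rule integrable_if_powr_integrable) fact+
  have [measurable]: "b \<in> borel_measurable M" "u \<in> borel_measurable M"
    using measurable_from_subalg[OF F] b_F u_F by auto
  have C_nn: "0 \<le> C" and U_nn: "0 \<le> U"
    using b_le u_le norm_ge_zero order_trans by blast+
  define Y where "Y \<omega> = (clip t (b \<omega> + \<xi> \<omega>) - b \<omega>) \<bullet> u \<omega>" for \<omega>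
  define R where "R \<omega> = clip t (b \<omega> + \<xi> \<omega>) - (b \<omega> + \<xi> \<omega>)" for \<omega>
  define s where "s \<omega> = sgn (real_cond_exp M F Y \<omega>)" for \<omega>
  have [measurable]: "Y \<in> borel_measurable M" "R \<in> borel_measurable M"
    unfolding Y_def[abs_def] R_def[abs_def] by measurable
  have s_F: "s \<in> borel_measurable F"
    unfolding s_def[abs_def] by measurable
  then have [measurable]: "s \<in> borel_measurable M"
    using measurable_from_subalg[OF F] by blast
  have s_le: "\<bar>s \<omega>\<bar> \<le> 1" for \<omega>
    by (simp add: s_def sgn_if)
  have su_le: "norm (s \<omega> *\<^sub>R u \<omega>) \<le> U" for \<omega>
    using mult_mono[OF s_le u_le[of \<omega>]] by simp

  \<comment> \<open>\<open>K\<close> bounds the \<open>\<delta>\<close>-moment of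
    \<open>b + \<xi>\<close>; the truncation estimate then bounds the mean of
    \<open>norm R\<close>.\<close>
  define K where "K = 2 powr \<delta> * (C powr \<delta> + \<nu> powr \<delta>)"
  have R_le: "norm (R \<omega>) \<le> t powr (1 - \<delta>) * (2 powr \<delta> * (C powr \<delta> + norm (\<xi> \<omega>) powr \<delta>))" for \<omega>
  proof -
    have "norm (b \<omega> + \<xi> \<omega>) powr \<delta> \<le> (C + norm (\<xi> \<omega>)) powr \<delta>"
      using \<open>1 < \<delta>\<close> b_le[of \<omega>] norm_triangle_ineq[of "b \<omega>" "\<xi> \<omega>"] by (intro powr_mono2) auto
    also have "\<dots> \<le> 2 powr \<delta> * (C powr \<delta> + norm (\<xi> \<omega>) powr \<delta>)"
      using \<open>1 < \<delta>\<close> C_nn by (intro powr_add_le) auto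
    finally have "t powr (1 - \<delta>) * norm (b \<omega> + \<xi> \<omega>) powr \<delta> \<le> t powr (1 - \<delta>) * (2 powr \<delta> * (C powr \<delta> + norm (\<xi> \<omega>) powr \<delta>))"
      by (intro mult_left_mono) auto
    with norm_clip_diff_le[OF \<open>0 < t\<close> \<open>1 < \<delta>\<close>, of "b \<omega> + \<xi> \<omega>"] show ?thesis
      by (simp add: R_def)
  qed
  have R_int: "integrable M (\<lambda>\<omega>. norm (R \<omega>))"
  proof (rule Bochner_Integration.integrable_bound)
    show "integrable M (\<lambda>\<omega>. t powr (1 - \<delta>) * (2 powr \<delta> * (C powr \<delta> + norm (\<xi> \<omega>) powr \<delta>)))"
      using mom by simp
    show "AE \<omega> in M. norm (norm (R \<omega>)) \<le> norm (t powr (1 - \<delta>) * (2 powr \<delta> * (C powr \<delta> + norm (\<xi> \<omega>) powr \<delta>)))"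
      using R_le by (simp add: abs_mult)
  qed measurable
  have "expectation (\<lambda>\<omega>. norm (R \<omega>)) \<le> expectation (\<lambda>\<omega>. t powr (1 - \<delta>) * (2 powr \<delta> * (C powr \<delta> + norm (\<xi> \<omega>) powr \<delta>)))"
    using mom by (intro integral_mono R_int R_le) simp
  also have "\<dots> = t powr (1 - \<delta>) * (2 powr \<delta> * (C powr \<delta> + expectation (\<lambda>\<omega>. norm (\<xi> \<omega>) powr \<delta>)))"
    using mom by (simp add: prob_space)
  also have "\<dots> \<le> t powr (1 - \<delta>) * K"
    unfolding K_def using mom by (intro mult_left_mono add_left_mono) auto
  finally have ER: "expectation (\<lambda>\<omega>. norm (R \<omega>)) \<le> t powr (1 - \<delta>) * K" .

  have Rsu_le: "\<bar>R \<omega> \<bullet> (s \<omega> *\<^sub>R u \<omega>)\<bar> \<le> U * norm (R \<omega>)" for \<omega>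
    using order_trans[OF Cauchy_Schwarz_ineq2 mult_left_mono[OF su_le norm_ge_zero]]
    by (subst mult.commute)
  have Rsu_int: "integrable M (\<lambda>\<omega>. R \<omega> \<bullet> (s \<omega> *\<^sub>R u \<omega>))"
  proof (rule Bochner_Integration.integrable_bound)
    show "integrable M (\<lambda>\<omega>. U * norm (R \<omega>))"
      using R_int by simp
    show "AE \<omega> in M. norm (R \<omega> \<bullet> (s \<omega> *\<^sub>R u \<omega>)) \<le> norm (U * norm (R \<omega>))"
      using Rsu_le U_nn by (simp add: abs_mult)
  qed measurable
  have su_F: "(\<lambda>\<omega>. s \<omega> *\<^sub>R u \<omega>) \<in> borel_measurable F"
    using s_F u_F by measurable
  note \<xi>su = vec_cond_exp_zero_orthogonal[OF F \<xi>_int zero su_F su_le]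
  \<comment> \<open>The cut-off part plus a noise part. The latter has mean zero because
    \<open>s\<close> and \<open>u\<close> are bounded and \<open>F\<close>-measurable.\<close>
  have sY: "s \<omega> * Y \<omega> = R \<omega> \<bullet> (s \<omega> *\<^sub>R u \<omega>) + \<xi> \<omega> \<bullet> (s \<omega> *\<^sub>R u \<omega>)" for \<omega>
    by (simp add: Y_def R_def algebra_simps)
  have sY_int: "integrable M (\<lambda>\<omega>. s \<omega> * Y \<omega>)"
    unfolding sY by (rule Bochner_Integration.integrable_add[OF Rsu_int \<xi>su(1)])
  have "expectation (\<lambda>\<omega>. \<bar>real_cond_exp M F Y \<omega>\<bar>) = expectation (\<lambda>\<omega>. s \<omega> * real_cond_exp M F Y \<omega>)"
    by (intro Bochner_Integration.integral_cong) (auto simp: s_def sgn_if)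
  also have "\<dots> = expectation (\<lambda>\<omega>. s \<omega> * Y \<omega>)"
    by (rule real_cond_exp_intg(2)[OF sY_int s_F]) measurable
  also have "\<dots> = expectation (\<lambda>\<omega>. R \<omega> \<bullet> (s \<omega> *\<^sub>R u \<omega>))"
    unfolding sY using Rsu_int \<xi>su by simp
  also have "\<dots> \<le> expectation (\<lambda>\<omega>. U * norm (R \<omega>))"
    using Rsu_le R_int by (intro integral_mono Rsu_int) (auto simp: abs_le_iff)
  also have "\<dots> \<le> U * (t powr (1 - \<delta>) * K)"
    using ER U_nn by (simp add: mult_left_mono)
  finally show ?thesis
    unfolding Y_def[abs_def] K_def by (simp add: mult_ac)
qed

text \<open>Doob decomposition of the terms \<open>Y k\<close>. Clipping bounds them by a multiple
  of \<open>\<tau> k + C\<close>, so the centred part has summable variances although the noise has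
  only a \<open>\<delta>\<close>-moment; the compensator \<open>B k\<close> is the clipping bias, of
  order \<open>\<tau> k powr (1 - \<delta>)\<close> in mean.\<close>

theorem (in prob_space) clipped_noise_AE_summable:
  fixes \<xi> b u :: "nat \<Rightarrow> 'a \<Rightarrow> real ^ 'n"
  assumes F: "\<And>k. subalgebra M (F k)" "\<And>k. subalgebra (F (Suc k)) (F k)"
    and \<xi>_F: "\<And>k. \<xi> k \<in> borel_measurable (F (Suc k))"
    and b_F: "\<And>k. b k \<in> borel_measurable (F k)" and b_le: "\<And>k \<omega>. norm (b k \<omega>) \<le> C"
    and u_F: "\<And>k. u k \<in> borel_measurable (F k)" and u_le: "\<And>k \<omega>. norm (u k \<omega>) \<le> U"
    and moment: "\<And>k. AE \<omega> in M. nn_cond_exp M (F k) (\<lambda>\<omega>. ennreal (norm (\<xi> k \<omega>) powr \<delta>)) \<omega> \<le> ennreal (\<nu> powr \<delta>)"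
    and zero: "\<And>k. AE \<omega> in M. vec_cond_exp M (F k) (\<xi> k) \<omega> = 0"
    and "1 < \<delta>" and \<alpha>: "\<And>k. 0 < \<alpha> k" and \<tau>: "\<And>k. 0 < \<tau> k"
    and sums: "summable (\<lambda>k. (\<alpha> k)\<^sup>2)" "summable (\<lambda>k. (\<alpha> k)\<^sup>2 * (\<tau> k)\<^sup>2)"
      "summable (\<lambda>k. \<alpha> k * \<tau> k powr (1 - \<delta>))"
  shows "AE \<omega> in M. summable (\<lambda>k. \<alpha> k * ((clip (\<tau> k) (b k \<omega> + \<xi> k \<omega>) - b k \<omega>) \<bullet> u k \<omega>))"
proof -
  define Y where "Y k \<omega> = (clip (\<tau> k) (b k \<omega> + \<xi> k \<omega>) - b k \<omega>) \<bullet> u k \<omega>" for k \<omega>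
  define B where "B k = real_cond_exp M (F k) (Y k)" for k
  define c where "c k = (\<tau> k + C) * U" for k
  have C_nn: "0 \<le> C" and U_nn: "0 \<le> U"
    using b_le u_le norm_ge_zero order_trans by blast+
  have Y_F: "Y k \<in> borel_measurable (F (Suc k))" for k
    using \<xi>_F[of k] measurable_from_subalg[OF F(2) b_F] measurable_from_subalg[OF F(2) u_F]
    unfolding Y_def[abs_def] by measurable
  have B_F: "B k \<in> borel_measurable (F k)" for k
    by (simp add: B_def)
  have B_F': "B k \<in> borel_measurable (F (Suc k))" for k
    by (rule measurable_from_subalg[OF F(2) B_F])
  have \<xi>_M: "\<xi> k \<in> borel_measurable M" for k
    by (rule measurable_from_subalg[OF F(1) \<xi>_F])
  have [measurable]: "Y k \<in> borel_measurable M" "B k \<in> borel_measurable M" for k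
    by (rule measurable_from_subalg[OF F(1) Y_F], rule measurable_from_subalg[OF F(1) B_F])
  have Y_le: "\<bar>Y k \<omega>\<bar> \<le> c k" for k \<omega>
  proof -
    have "norm (clip (\<tau> k) (b k \<omega> + \<xi> k \<omega>) - b k \<omega>) \<le> \<tau> k + C"
      using norm_triangle_ineq4[of "clip (\<tau> k) (b k \<omega> + \<xi> k \<omega>)" "b k \<omega>"] b_le[of k \<omega>]
        norm_clip_le[of "\<tau> k" "b k \<omega> + \<xi> k \<omega>"] \<tau>[of k] by simp
    then show ?thesis
      unfolding Y_def c_def using u_le[of k \<omega>] \<tau>[of k] C_nn
      by (intro order_trans[OF Cauchy_Schwarz_ineq2] mult_mono) auto
  qed
  have Y_int: "integrable M (Y k)" for k
    by (rule integrable_const_bound[of _ "c k"]) (auto simp: Y_le)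
  have cond: "sigma_finite_subalgebra M (F k)" for k
    by (rule finite_measure_subalgebra_is_sigma_finite) (use F in unfold_locales)
  have B_int: "integrable M (B k)" for k
    unfolding B_def using sigma_finite_subalgebra.real_cond_exp_int(1)[OF cond Y_int] .
  have B_le: "AE \<omega> in M. \<bar>B k \<omega>\<bar> \<le> c k" for k
  proof -
    have "- c k \<le> Y k \<omega>" "Y k \<omega> \<le> c k" for \<omega>
      using Y_le[of k \<omega>] by auto
    then have "AE \<omega> in M. - c k \<le> B k \<omega>" "AE \<omega> in M. B k \<omega> \<le> c k"
      unfolding B_def
      by (auto intro: sigma_finite_subalgebra.real_cond_exp_ge_c[OF cond Y_int]
          sigma_finite_subalgebra.real_cond_exp_le_c[OF cond Y_int])
    then show ?thesis
      by eventually_elim simp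
  qed

  define d where "d k \<omega> = \<alpha> k * (Y k \<omega> - B k \<omega>)" for k \<omega>
  have [measurable]: "d k \<in> borel_measurable M" for k
    unfolding d_def[abs_def] by measurable
  have d_sq: "AE \<omega> in M. (d k \<omega>)\<^sup>2 \<le> (\<alpha> k)\<^sup>2 * (2 * c k)\<^sup>2" for k
    using B_le[of k]
  proof eventually_elim
    case (elim \<omega>)
    then have "\<bar>Y k \<omega> - B k \<omega>\<bar> \<le> 2 * c k"
      using Y_le[of k \<omega>] by linarith
    then have "(Y k \<omega> - B k \<omega>)\<^sup>2 \<le> (2 * c k)\<^sup>2"
      by (rule power2_le_iff_abs_le[THEN iffD2, rotated]) (use elim in linarith)
    then show ?case
      by (simp add: d_def power_mult_distrib mult_left_mono)
  qed
  have d_int: "integrable M (\<lambda>\<omega>. (d k \<omega>)\<^sup>2)" for k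
    by (rule integrable_const_bound[of _ "(\<alpha> k)\<^sup>2 * (2 * c k)\<^sup>2"]) (use d_sq in auto)
  \<comment> \<open>The factor 8 combines
    \<open>\<bar>Y k \<omega> - B k \<omega>\<bar> \<le> 2 * c k\<close> with \<open>(\<tau> k +
    C)\<^sup>2 \<le> 2 * (\<tau> k)\<^sup>2 + 2 * C\<^sup>2\<close>.\<close>
  have Ed: "expectation (\<lambda>\<omega>. (d k \<omega>)\<^sup>2) \<le> 8 * U\<^sup>2 * ((\<alpha> k)\<^sup>2 * (\<tau> k)\<^sup>2) + 8 * U\<^sup>2 * C\<^sup>2 * (\<alpha> k)\<^sup>2" for k
  proof -
    have "expectation (\<lambda>\<omega>. (d k \<omega>)\<^sup>2) \<le> expectation (\<lambda>\<omega>. (\<alpha> k)\<^sup>2 * (2 * c k)\<^sup>2)"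
      by (intro integral_mono_AE d_int d_sq) simp
    also have "\<dots> = 4 * (\<alpha> k)\<^sup>2 * U\<^sup>2 * (\<tau> k + C)\<^sup>2"
      by (simp add: prob_space c_def power_mult_distrib)
    also have "\<dots> \<le> 4 * (\<alpha> k)\<^sup>2 * U\<^sup>2 * (2 * (\<tau> k)\<^sup>2 + 2 * C\<^sup>2)"
      using zero_le_power2[of "\<tau> k - C"]
      by (intro mult_left_mono) (simp_all add: power2_sum power2_diff)
    finally show ?thesis
      by (simp add: algebra_simps)
  qed
  have mart: "AE \<omega> in M. summable (\<lambda>k. d k \<omega>)"
  proof (rule martingale_difference_AE_summable[where F = F])
    show "d k \<in> borel_measurable (F (Suc k))" for k
      using Y_F[of k] B_F'[of k] unfolding d_def[abs_def] by measurable
    show "summable (\<lambda>k. expectation (\<lambda>\<omega>. (d k \<omega>)\<^sup>2))"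
    proof (rule summable_comparison_test')
      show "summable (\<lambda>k. 8 * U\<^sup>2 * ((\<alpha> k)\<^sup>2 * (\<tau> k)\<^sup>2) + 8 * U\<^sup>2 * C\<^sup>2 * (\<alpha> k)\<^sup>2)"
        using sums by (intro summable_add summable_mult)
      show "norm (expectation (\<lambda>\<omega>. (d k \<omega>)\<^sup>2)) \<le> 8 * U\<^sup>2 * ((\<alpha> k)\<^sup>2 * (\<tau> k)\<^sup>2) + 8 * U\<^sup>2 * C\<^sup>2 * (\<alpha> k)\<^sup>2"
        if "0 \<le> k" for k
        using Ed[of k] by simp
    qed
    fix k and h :: "'a \<Rightarrow> real" and H
    assume h_F: "h \<in> borel_measurable (F k)" and h_le: "\<And>\<omega>. \<bar>h \<omega>\<bar> \<le> H"
    have [measurable]: "h \<in> borel_measurable M"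
      by (rule measurable_from_subalg[OF F(1) h_F])
    have H_nn: "0 \<le> H"
      using h_le abs_ge_zero order_trans by blast
    have hY: "integrable M (\<lambda>\<omega>. h \<omega> * Y k \<omega>)"
      by (rule integrable_const_bound[of _ "H * c k"])
        (use h_le Y_le H_nn in \<open>auto simp: abs_mult intro!: mult_mono\<close>)
    have hB: "integrable M (\<lambda>\<omega>. h \<omega> * B k \<omega>)" "expectation (\<lambda>\<omega>. h \<omega> * B k \<omega>) = expectation (\<lambda>\<omega>. h \<omega> * Y k \<omega>)"
      using sigma_finite_subalgebra.real_cond_exp_intg[OF cond hY h_F] by (simp_all add: B_def)
    have "h \<omega> * d k \<omega> = \<alpha> k * (h \<omega> * Y k \<omega> - h \<omega> * B k \<omega>)" for \<omega>
      by (simp add: d_def algebra_simps)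
    then show "expectation (\<lambda>\<omega>. h \<omega> * d k \<omega>) = 0"
      using hY hB by simp
  qed (fact F d_int)+

  \<comment> \<open>The bias series converges even absolutely, so bounds in mean suffice.\<close>
  have bias: "AE \<omega> in M. summable (\<lambda>k. \<alpha> k * B k \<omega>)"
  proof (rule AE_summable_if_summable_integral)
    define K where "K = U * (2 powr \<delta> * (C powr \<delta> + \<nu> powr \<delta>))"
    show "summable (\<lambda>k. expectation (\<lambda>\<omega>. \<bar>\<alpha> k * B k \<omega>\<bar>))"
    proof (rule summable_comparison_test')
      show "summable (\<lambda>k. K * (\<alpha> k * \<tau> k powr (1 - \<delta>)))"
        using sums by (intro summable_mult)
      show "norm (expectation (\<lambda>\<omega>. \<bar>\<alpha> k * B k \<omega>\<bar>)) \<le> K * (\<alpha> k * \<tau> k powr (1 - \<delta>))" if "0 \<le> k" for k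
      proof -
        have "expectation (\<lambda>\<omega>. \<bar>B k \<omega>\<bar>) \<le> K * \<tau> k powr (1 - \<delta>)"
          unfolding B_def Y_def[abs_def] K_def
          by (rule clip_bias_le[OF F(1) \<xi>_M b_F b_le u_F u_le moment zero \<open>1 < \<delta>\<close> \<tau>])
        then have "\<alpha> k * expectation (\<lambda>\<omega>. \<bar>B k \<omega>\<bar>) \<le> \<alpha> k * (K * \<tau> k powr (1 - \<delta>))"
          using \<alpha>[of k] by (intro mult_left_mono) auto
        then show ?thesis
          using \<alpha>[of k] by (simp add: abs_mult mult_ac)
      qed
    qed
  qed (use B_int in simp)
  from mart bias show ?thesis
  proof eventually_elim
    case (elim \<omega>)
    from summable_add[OF this] show ?case
      by (simp add: d_def Y_def algebra_simps)
  qed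
qed

section \<open>Measurability of the iterates\<close>

lemma space_noise_history: "space (noise_history M \<xi> k) = space M"
  by (simp add: noise_history_def space_measure_of_conv)

lemma sets_noise_history:
  "sets (noise_history M \<xi> k) =
    sigma_sets (space M) {\<xi> i m -` B \<inter> space M | i m B. m < k \<and> B \<in> sets borel}"
  unfolding noise_history_def by (rule sets_measure_of) auto

lemma subalgebra_noise_history:
  assumes "\<And>i k. \<xi> i k \<in> borel_measurable M"
  shows "subalgebra M (noise_history M \<xi> k)"
proof -
  have "{\<xi> i m -` B \<inter> space M | i m B. m < k \<and> B \<in> sets borel} \<subseteq> sets M"
    using measurable_sets[OF assms] by blast
  then show ?thesis
    unfolding subalgebra_def space_noise_history sets_noise_history
    by (simp add: sets.sigma_sets_subset)
qed

lemma subalgebra_noise_history_Suc: "subalgebra (noise_history M \<xi> (Suc k)) (noise_history M \<xi> k)"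
  unfolding subalgebra_def space_noise_history sets_noise_history
  by (intro conjI refl sigma_sets_mono') (blast intro: less_SucI)

lemma borel_measurable_noise_history:
  assumes "m < k"
  shows "\<xi> i m \<in> borel_measurable (noise_history M \<xi> k)"
proof (rule measurableI)
  show "\<xi> i m -` B \<inter> space (noise_history M \<xi> k) \<in> sets (noise_history M \<xi> k)" if "B \<in> sets borel" for B
    unfolding space_noise_history sets_noise_history using assms that by (intro sigma_sets.Basic) blast
qed simp

lemma clipped_dsgp_in:
  assumes "closed S" "S \<noteq> {}" "\<And>i. x0 i \<in> S"
  shows "clipped_dsgp A S G \<alpha> \<tau> x0 z k i \<in> S"
  using assms by (cases k) (auto simp: Let_def closest_point_in_set)

lemma sum_clipped_dsgp_in:
  assumes "doubly_stochastic A" "convex S" "closed S" "S \<noteq> {}" "\<And>i. x0 i \<in> S"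
  shows "(\<Sum>j\<in>UNIV. A $ i $ j *\<^sub>R clipped_dsgp A S G \<alpha> \<tau> x0 z k j) \<in> S"
  using assms by (intro convex_sum clipped_dsgp_in) (auto simp: doubly_stochastic_def)

text \<open>Composition with the projection extends \<open>g\<close> continuously to the whole space
  and changes nothing on values of \<open>v\<close>.\<close>

lemma borel_measurable_continuous_on_into:
  fixes v :: "'w \<Rightarrow> 'a::euclidean_space" and g :: "'a \<Rightarrow> 'b::euclidean_space"
  assumes "continuous_on S g" "convex S" "closed S" "S \<noteq> {}"
    and v: "v \<in> borel_measurable N" "\<And>\<omega>. v \<omega> \<in> S"
  shows "(\<lambda>\<omega>. g (v \<omega>)) \<in> borel_measurable N"
proof -
  have "continuous_on UNIV (g \<circ> closest_point S)"
    using assms(1-4) closest_point_in_set[OF assms(3,4)]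
    by (intro continuous_on_compose continuous_on_closest_point) (auto elim!: continuous_on_subset)
  from measurable_compose[OF v(1) borel_measurable_continuous_onI[OF this]]
  show ?thesis
    using v(2) by (simp add: closest_point_self)
qed

text \<open>The iterate after \<open>k\<close> steps depends only on noises with index below
  \<open>k\<close>, the generators of \<open>noise_history M \<xi> k\<close>. So the mixed points
  and gradients of step \<open>k\<close> are known before \<open>\<xi> i k\<close> is drawn.\<close>

lemma borel_measurable_clipped_dsgp:
  fixes A :: "real ^ 'v ^ 'v" and x0 :: "'v \<Rightarrow> 'a::euclidean_space"
  assumes "doubly_stochastic A" and S: "convex S" "closed S" "S \<noteq> {}" and x0: "\<And>i. x0 i \<in> S"
    and G: "\<And>i. continuous_on S (G i)"
  shows "(\<lambda>\<omega>. clipped_dsgp A S G \<alpha> \<tau> x0 (\<lambda>i k. \<xi> i k \<omega>) k i) \<in> borel_measurable (noise_history M \<xi> k)"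
proof (induction k arbitrary: i)
  case (Suc k)
  let ?F = "noise_history M \<xi> (Suc k)"
  let ?v = "\<lambda>\<omega>. \<Sum>j\<in>UNIV. A $ i $ j *\<^sub>R clipped_dsgp A S G \<alpha> \<tau> x0 (\<lambda>i k. \<xi> i k \<omega>) k j"
  have [measurable]: "(\<lambda>\<omega>. clipped_dsgp A S G \<alpha> \<tau> x0 (\<lambda>i k. \<xi> i k \<omega>) k j) \<in> borel_measurable ?F" for j
    by (rule measurable_from_subalg[OF subalgebra_noise_history_Suc Suc])
  have v [measurable]: "?v \<in> borel_measurable ?F"
    by measurable
  have [measurable]: "(\<lambda>\<omega>. G i (?v \<omega>)) \<in> borel_measurable ?F"
    using assms by (intro borel_measurable_continuous_on_into[OF G S v] sum_clipped_dsgp_in)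
  \<comment> \<open>Step \<open>k\<close> produces iterate \<open>Suc k\<close>, whose history just
    includes index \<open>k\<close>.\<close>
  have [measurable]: "\<xi> i k \<in> borel_measurable ?F"
    by (rule borel_measurable_noise_history) simp
  have [measurable]: "closest_point S \<in> borel_measurable borel"
    using S by (intro borel_measurable_continuous_onI continuous_on_closest_point)
  show ?case
    unfolding clipped_dsgp.simps Let_def by measurable
qed simp

section \<open>Almost sure convergence\<close>

theorem theorem2:
  fixes M :: "'w measure"
    and A :: "real ^ 'v ^ 'v"
    and \<Omega> :: "(real ^ 'n) set"
    and f :: "'v \<Rightarrow> real ^ 'n \<Rightarrow> real"
    and G :: "'v \<Rightarrow> real ^ 'n \<Rightarrow> real ^ 'n"
    and x0 :: "'v \<Rightarrow> real ^ 'n"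
    and \<xi> :: "'v \<Rightarrow> nat \<Rightarrow> 'w \<Rightarrow> real ^ 'n"
    and \<alpha> \<tau> :: "nat \<Rightarrow> real"
    and \<eta> C0 \<delta> \<nu> :: real
  assumes "CARD('v) > 1"
    and "prob_space M"
    and "doubly_stochastic A"
    and "\<And>i. i \<in> in_neighbors A i"
    and "strongly_connected (comm_graph A)"
    and "0 < \<eta>" and "\<eta> < 1"
    and "\<And>i j. j \<in> in_neighbors A i \<Longrightarrow> A $ i $ j \<ge> \<eta>"
    and "\<And>i. continuous_gradient_on \<Omega> (f i) (G i)"
    and "\<And>i. convex_on \<Omega> (f i)"
    and "\<Omega> \<noteq> {}" and "closed \<Omega>" and "convex \<Omega>" and "bounded \<Omega>"
    and "C0 > 0"
    and "\<And>i \<theta>. \<theta> \<in> \<Omega> \<Longrightarrow> norm (G i \<theta>) \<le> C0"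
    and "minimizers (\<lambda>\<theta>. \<Sum>i\<in>UNIV. f i \<theta>) \<Omega> \<noteq> {}"
    and "\<And>i. x0 i \<in> \<Omega>"
    and "\<And>i k. \<xi> i k \<in> borel_measurable M"
    and "1 < \<delta>" and "\<delta> \<le> 2" and "\<nu> > 0"
    and "\<And>i k. AE \<omega> in M.
           nn_cond_exp M (noise_history M \<xi> k) (\<lambda>\<omega>. ennreal (norm (\<xi> i k \<omega>) powr \<delta>)) \<omega>
             \<le> ennreal (\<nu> powr \<delta>)"
    and "\<And>i k. AE \<omega> in M. vec_cond_exp M (noise_history M \<xi> k) (\<xi> i k) \<omega> = 0"
    and "\<And>k. \<alpha> k > 0" and "\<And>k. \<tau> k > 0"
    and "decseq \<alpha>" and "incseq \<tau>"
    and "\<exists>k1>0. \<forall>k\<ge>k1. \<tau> k \<ge> 2 * C0"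
    and "filterlim (\<lambda>n. \<Sum>k<n. \<alpha> k) at_top sequentially"
    and "summable (\<lambda>k. (\<alpha> k)\<^sup>2)"
    and "(\<lambda>k. \<alpha> k * \<tau> k) \<longlonglongrightarrow> 0"
    and "summable (\<lambda>k. (\<alpha> k)\<^sup>2 * (\<tau> k)\<^sup>2)"
    and "summable (\<lambda>k. \<alpha> k * \<tau> k powr (1 - \<delta>))"
  shows "AE \<omega> in M. \<forall>i. \<exists>\<theta> \<in> minimizers (\<lambda>\<theta>. \<Sum>i\<in>UNIV. f i \<theta>) \<Omega>.
           (\<lambda>k. clipped_dsgp A \<Omega> G \<alpha> \<tau> x0 (\<lambda>i k. \<xi> i k \<omega>) k i) \<longlonglongrightarrow> \<theta>"
proof -
  interpret prob_space M
    by fact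
  note S = assms(11-14)
  let ?x = "\<lambda>\<omega>. clipped_dsgp A \<Omega> G \<alpha> \<tau> x0 (\<lambda>i k. \<xi> i k \<omega>)"
  define v where "v i k \<omega> = (\<Sum>j\<in>UNIV. A $ i $ j *\<^sub>R ?x \<omega> k j)" for i k \<omega>
  define \<zeta> where "\<zeta> i k \<omega> = clip (\<tau> k) (G i (v i k \<omega>) + \<xi> i k \<omega>) - G i (v i k \<omega>)" for i k \<omega>
  have G_cont: "continuous_on \<Omega> (G i)" for i
    using assms(9)[of i] by (simp add: continuous_gradient_on_def)
  have v_in: "v i k \<omega> \<in> \<Omega>" for i k \<omega>
    unfolding v_def using assms(3,18) S by (intro sum_clipped_dsgp_in)
  have v_F: "v i k \<in> borel_measurable (noise_history M \<xi> k)" for i k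
    unfolding v_def[abs_def] using assms(3,18) S G_cont
    by (intro borel_measurable_sum borel_measurable_scaleR borel_measurable_const borel_measurable_clipped_dsgp)
  have Gv_F: "(\<lambda>\<omega>. G i (v i k \<omega>)) \<in> borel_measurable (noise_history M \<xi> k)" for i k
    using S by (intro borel_measurable_continuous_on_into[OF G_cont _ _ _ v_F v_in])
  \<comment> \<open>The direction \<open>u\<close> is left open: it is taken once as the mixed point
    and once as a constant basis vector.\<close>
  have noise: "AE \<omega> in M. summable (\<lambda>k. \<alpha> k * (\<zeta> i k \<omega> \<bullet> u k \<omega>))"
    if "\<And>k. u k \<in> borel_measurable (noise_history M \<xi> k)" "\<And>k \<omega>. norm (u k \<omega>) \<le> U" for i u U
    unfolding \<zeta>_def
  proof (rule clipped_noise_AE_summable[where F = "noise_history M \<xi>" and \<xi> = "\<xi> i" and C = C0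
        and b = "\<lambda>k \<omega>. G i (v i k \<omega>)" and u = u and U = U and \<alpha> = \<alpha> and \<tau> = \<tau> and \<delta> = \<delta> and \<nu> = \<nu>])
    show "subalgebra M (noise_history M \<xi> k)" for k
      by (rule subalgebra_noise_history) (fact assms(19))
    show "\<xi> i k \<in> borel_measurable (noise_history M \<xi> (Suc k))" for k
      by (rule borel_measurable_noise_history) simp
    show "norm (G i (v i k \<omega>)) \<le> C0" for k \<omega>
      by (intro assms(16) v_in)
  qed (fact subalgebra_noise_history_Suc Gv_F that assms)+
  \<comment> \<open>The noise terms of the Lyapunov functions are affine in the reference point, so these finitely
    many series give one null set for all minimizers.\<close>
  obtain U where "\<And>\<theta>. \<theta> \<in> \<Omega> \<Longrightarrow> norm \<theta> \<le> U"
    using \<open>bounded \<Omega>\<close> unfolding bounded_iff by blast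
  then have "AE \<omega> in M. \<forall>i. summable (\<lambda>k. \<alpha> k * (\<zeta> i k \<omega> \<bullet> v i k \<omega>))"
    using v_in by (intro eventually_all_finite noise[OF v_F]) auto
  moreover have "AE \<omega> in M. summable (\<lambda>k. \<alpha> k * (\<zeta> i k \<omega> \<bullet> e))" if "e \<in> Basis" for i e
    using that by (intro noise[OF _ eq_refl[OF norm_Basis]]) auto
  then have "AE \<omega> in M. \<forall>i. \<forall>e\<in>Basis. summable (\<lambda>k. \<alpha> k * (\<zeta> i k \<omega> \<bullet> e))"
    by (intro eventually_all_finite AE_finite_allI) auto
  ultimately show ?thesis
  proof eventually_elim
    case (elim \<omega>)
    define X where "X k = (\<chi> i. ?x \<omega> k i)" for k
    have mix_X: "mix A (X k) $ i = v i k \<omega>" for k i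
      by (simp add: mix_def X_def v_def)
    \<comment> \<open>One limit common to all agents, from which the claim for each agent
      follows.\<close>
    have "\<exists>\<theta>\<in>minimizers (\<lambda>\<theta>. \<Sum>i\<in>UNIV. f i \<theta>) \<Omega>. \<forall>i. (\<lambda>k. X k $ i) \<longlonglongrightarrow> \<theta>"
    proof (rule distributed_projection_convergence[where
          g = "\<lambda>k i. clip (\<tau> k) (G i (v i k \<omega>) + \<xi> i k \<omega>)" and G = G and A = A and C = C0 and \<alpha> = \<alpha> and \<tau> = \<tau>])
      show "X (Suc k) $ i = closest_point \<Omega> (mix A (X k) $ i - \<alpha> k *\<^sub>R clip (\<tau> k) (G i (v i k \<omega>) + \<xi> i k \<omega>))" for k i
        unfolding mix_X by (simp add: X_def v_def Let_def)
      show "norm (clip (\<tau> k) (G i (v i k \<omega>) + \<xi> i k \<omega>)) \<le> \<tau> k" for k i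
        using assms(26)[of k] by (intro norm_clip_le) simp
      fix \<theta> :: "real ^ 'n"
      \<comment> \<open>Expanding \<open>\<theta>\<close> in the basis writes the required series as
        a finite combination of series already known to converge at this
        \<open>\<omega>\<close>.\<close>
      have "summable (\<lambda>k. \<Sum>i\<in>UNIV. \<alpha> k * (\<zeta> i k \<omega> \<bullet> v i k \<omega>)
          - (\<Sum>e\<in>Basis. (\<theta> \<bullet> e) * (\<alpha> k * (\<zeta> i k \<omega> \<bullet> e))))"
        using elim by (intro summable_sum summable_diff summable_mult) auto
      moreover have "\<alpha> k * (\<zeta> i k \<omega> \<bullet> v i k \<omega>) - (\<Sum>e\<in>Basis. (\<theta> \<bullet> e) * (\<alpha> k * (\<zeta> i k \<omega> \<bullet> e)))
          = \<alpha> k * (\<zeta> i k \<omega> \<bullet> (v i k \<omega> - \<theta>))" for k i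
        by (simp add: inner_diff_right right_diff_distrib euclidean_inner[of "\<zeta> i k \<omega>" \<theta>]
            sum_distrib_left mult_ac)
      ultimately show "summable (\<lambda>k. \<alpha> k * (\<Sum>i\<in>UNIV.
          (clip (\<tau> k) (G i (v i k \<omega>) + \<xi> i k \<omega>) - G i (mix A (X k) $ i)) \<bullet> (mix A (X k) $ i - \<theta>)))"
        unfolding mix_X \<zeta>_def[symmetric] by (simp add: sum_distrib_left)
    qed (use assms in \<open>simp_all add: X_def\<close>)
    then show ?case
      by (auto simp: X_def)
  qed
qed

end
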